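(* Suppose that all quadrature states $\widehat{\mathbf U}_j^{[\alpha]}$ ($1\le j\le N_x$, $1\le\alpha\le L$) at time level $t^n$ and all exterior boundary traces belong to $\mathcal G_{B_{\rm const}}$. Assume that at every interface the wave speeds satisfy $$a^-<\min\{0,\alpha_l(\mathbf U^-,\mathbf U^+;\mathbf e_1)\},\qquad a^+>\max\{0,\alpha_r(\mathbf U^+,\mathbf U^-;\mathbf e_1)\},$$ that $\lambda>0$ satisfies $$\lambda\max\{\alpha_j+a_{j-1/2}^+,\ \alpha_j-a_{j+1/2}^-\}<\widehat\omega_1,\qquad 1\le j\le N_x,$$ and that, for all $1\le r\le M$, at every interface and in every cell respectively, $$\eta_r(\mathbf H_{j+1/2})\le\mathscr E_{j+1/2,r}^{\rm HLL},\qquad \eta_r(\mathbf\Xi_j)\le\mathscr E_{j,r}^{\Xi}.$$ Then the cell-average update $\overline{\mathbf U}_j^{n+1}=\overline{\mathbf U}_j^n-\lambda(\widehat{\mathbf F}_{1,j+1/2}-\widehat{\mathbf F}_{1,j-1/2})$ is weakly multi-entropy stable with respect to the budgets $\mathcal B_{j,r}^n$, i.e. for every $1\le j\le N_x$ and every $1\le r\le M$, $$\overline{\mathbf U}_j^{n+1}\in\mathcal G_{B_{\rm const}},\qquad \eta_r(\overline{\mathbf U}_j^{n+1})\le\mathcal B_{j,r}^n .$$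
   Context: **States, flux, entropies.** Fix $\gamma>1$. A state is $\mathbf U=(\rho,\mathbf m^\top,\mathbf B^\top,E)^\top\in\mathbb R^8$ with $\mathbf m,\mathbf B\in\mathbb R^3$; $\mathbf v=\mathbf m/\rho$, $p=(\gamma-1)(E-\frac{|\mathbf m|^2}{2\rho}-\frac{|\mathbf B|^2}{2})$, $p_{\rm tot}=p+\frac{|\mathbf B|^2}2$. Admissible set $\mathcal G=\{\mathbf U:\rho>0,\ E-\frac{|\mathbf m|^2}{2\rho}-\frac{|\mathbf B|^2}{2}>0\}$. For fixed $B_{\rm const}\in\mathbb R$, $\mathcal G_{B_{\rm const}}=\{\mathbf U\in\mathcal G:B_1=B_{\rm const}\}$. The flux is $\mathbf F_1(\mathbf U)=(\rho v_1,(v_1\mathbf m-B_1\mathbf B+p_{\rm tot}\mathbf e_1)^\top,(v_1\mathbf B-B_1\mathbf v)^\top,v_1(E+p_{\rm tot})-B_1(\mathbf v\cdot\mathbf B))^\top$, $\mathbf e_1=(1,0,0)^\top$. Let $f_1,\dots,f_M\in C^2(\mathbb R)$ satisfy $f_r'>0$ and $f_r'-\gamma f_r''>0$ on $\mathbb R$; with $s=\log p-\gamma\log\rho$ set $\eta_r(\mathbf U)=-\rho f_r(s)$, $q_r(\mathbf U)=v_1\eta_r(\mathbf U)$ on $\mathcal G$. **Splitting speeds.** For $\mathbf U,\widetilde{\mathbf U}\in\mathcal G$ and a unit vector $\xi$: $\mathcal C(\mathbf U;\xi)=\frac1{\sqrt2}\Big[\mathcal C_s^2+\frac{|\mathbf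 B|^2}\rho+\sqrt{(\mathcal C_s^2+\frac{|\mathbf B|^2}\rho)^2-4\frac{\mathcal C_s^2(\xi\cdot\mathbf B)^2}{\rho}}\Big]^{1/2}$, $\mathcal C_s^2=\frac{(\gamma-1)p}{2\rho}$. With $\widehat{\mathbf v}=\frac{\sqrt\rho\mathbf v+\sqrt{\tilde\rho}\tilde{\mathbf v}}{\sqrt\rho+\sqrt{\tilde\rho}}$ and $\mathfrak b=\frac{|\mathbf B-\widetilde{\mathbf B}|}{\sqrt\rho+\sqrt{\tilde\rho}}$, $\alpha_r(\mathbf U,\widetilde{\mathbf U};\xi)=\max\{\mathbf v\cdot\xi,\widehat{\mathbf v}\cdot\xi\}+\mathcal C(\mathbf U;\xi)+\mathfrak b$, $\alpha_l(\mathbf U,\widetilde{\mathbf U};\xi)=\min\{\mathbf v\cdot\xi,\widehat{\mathbf v}\cdot\xi\}-\mathcal C(\mathbf U;\xi)-\mathfrak b$, $\alpha_\star(\mathbf U,\widetilde{\mathbf U};\xi)=\max\{|\mathbf v\cdot\xi|,|\widehat{\mathbf v}\cdot\xi|\}+\mathcal C(\mathbf U;\xi)+\mathfrak b$. **Mesh and data.** Uniform cells $I_j=[x_{j-1/2},x_{j+1/2}]$, $1\le j\le N_x$, width $\Delta x$. On each cell $\mathbf U_j^n\in[\mathbb P^k(I_j)]^8$ ($k\ge0$) with $B_{1,j}^n\equiv B_{\rm const}$. Use the $L$-point Gauss–Lobatto rule on $I_j$ with $L\ge2$, $2L-3\ge k$, nodes $\widehat x_j^{[\alpha]}$, weights $\widehat\omega_\alpha>0$,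 $\sum_\alpha\widehat\omega_\alpha=1$, $\widehat\omega_1=\widehat\omega_L=\frac1{L(L-1)}$. (For $k=0$ take $L=2$.) Set $\widehat{\mathbf U}_j^{[\alpha]}=\mathbf U_j^n(\widehat x_j^{[\alpha]})$, $\overline{\mathbf U}_j^n=\frac1{\Delta x}\int_{I_j}\mathbf U_j^n\,dx=\sum_\alpha\widehat\omega_\alpha\widehat{\mathbf U}_j^{[\alpha]}$, $\mathbf U_{j,L}=\widehat{\mathbf U}_j^{[1]}=\mathbf U_{j-1/2}^+$, $\mathbf U_{j,R}=\widehat{\mathbf U}_j^{[L]}=\mathbf U_{j+1/2}^-$. So at interface $x_{j+1/2}$ ($0\le j\le N_x$) the traces are $\mathbf U^-=\mathbf U_{j+1/2}^-$ (from the left) and $\mathbf U^+=\mathbf U_{j+1/2}^+$ (from the right); at the two domain endpoints the missing trace is a prescribed exterior boundary trace. Put $\alpha_j=\max\{\alpha_\star(\mathbf U_{j,R},\mathbf U_{j,L};\mathbf e_1),\alpha_\star(\mathbf U_{j,L},\mathbf U_{j,R};\mathbf e_1)\}$. **Scheme.** At each interface, given wave speeds $a^-<0<a^+$ (shared by both adjacent cells), $\widehat{\mathbf F}_1=\frac{a^+\mathbf F_1(\mathbf U^-)-a^-\mathbf F_1(\mathbf U^+)+a^+a^-(\mathbf U^+-\mathbf U^-)}{a^+-a^-}$, $\mathbf H=\frac{a^+\mathbf U^+-a^-\mathbf U^--\mathbf F_1(\mathbf U^+)+\mathbf F_1(\mathbf U^-)}{a^+-a^-}$, $\widehat q_r=\frac{a^+q_r(\mathbf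 U^-)-a^-q_r(\mathbf U^+)+a^+a^-(\eta_r(\mathbf U^+)-\eta_r(\mathbf U^-))}{a^+-a^-}$, $\mathscr E_r^{\rm HLL}=\frac{a^+\eta_r(\mathbf U^+)-a^-\eta_r(\mathbf U^-)-q_r(\mathbf U^+)+q_r(\mathbf U^-)}{a^+-a^-}$; a subscript $j+1/2$ denotes evaluation at $x_{j+1/2}$. For a time step $\tau>0$, $\lambda=\tau/\Delta x$. **Entropy budget.** $\mathcal B_{j,r}^n=\sum_{\alpha=1}^L\widehat\omega_\alpha\eta_r(\widehat{\mathbf U}_j^{[\alpha]})-\lambda(\widehat q_{j+1/2,r}-\widehat q_{j-1/2,r})$. **Interior splitting state.** $\beta_{j,L}=\frac{\widehat\omega_1}\lambda-a_{j-1/2}^+$, $\beta_{j,R}=\frac{\widehat\omega_1}\lambda+a_{j+1/2}^-$, $D_j=\beta_{j,L}+\beta_{j,R}$, $\mathbf\Xi_j=\frac{\beta_{j,R}\mathbf U_{j,R}+\beta_{j,L}\mathbf U_{j,L}-\mathbf F_1(\mathbf U_{j,R})+\mathbf F_1(\mathbf U_{j,L})}{D_j}$, $\mathscr E_{j,r}^{\Xi}=\frac{\beta_{j,R}\eta_r(\mathbf U_{j,R})+\beta_{j,L}\eta_r(\mathbf U_{j,L})-q_r(\mathbf U_{j,R})+q_r(\mathbf U_{j,L})}{D_j}$. (Under the stated speed and CFL conditions $D_j>0$ and $\mathbf H_{j+1/2},\mathbf\Xi_j\in\mathcal G_{B_{\rm const}}$, so the entropies are defined.) *)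

theory Defs
  imports "HOL-Analysis.Analysis" "HOL-Computational_Algebra.Polynomial"
begin

section \<open>States, flux and entropies\<close>

text \<open>A state \<open>(\<rho>, m, B, E)\<close> lives in \<open>\<real> \<times> \<real>\<^sup>3 \<times> \<real>\<^sup>3 \<times> \<real>\<close>, which is \<open>\<real>\<^sup>8\<close> with its
  Euclidean vector-space structure.\<close>

type_synonym state = "real \<times> (real^3) \<times> (real^3) \<times> real"

definition dens :: "state \<Rightarrow> real" where "dens U = fst U"
definition mom :: "state \<Rightarrow> real^3" where "mom U = fst (snd U)"
definition mag :: "state \<Rightarrow> real^3" where "mag U = fst (snd (snd U))"
definition ener :: "state \<Rightarrow> real" where "ener U = snd (snd (snd U))"

definition vel :: "state \<Rightarrow> real^3" where
  "vel U = (1 / dens U) *\<^sub>R mom U"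

definition int_energy :: "state \<Rightarrow> real" where
  "int_energy U = ener U - (norm (mom U))\<^sup>2 / (2 * dens U) - (norm (mag U))\<^sup>2 / 2"

definition pres :: "real \<Rightarrow> state \<Rightarrow> real" where
  "pres \<gamma> U = (\<gamma> - 1) * int_energy U"

definition ptot :: "real \<Rightarrow> state \<Rightarrow> real" where
  "ptot \<gamma> U = pres \<gamma> U + (norm (mag U))\<^sup>2 / 2"

definition admissible :: "state set" where
  "admissible = {U. dens U > 0 \<and> int_energy U > 0}"

definition admissible_B :: "real \<Rightarrow> state set" where
  "admissible_B b = {U \<in> admissible. mag U $ 1 = b}"

definition e1 :: "real^3" where "e1 = axis 1 1"

definition flux :: "real \<Rightarrow> state \<Rightarrow> state" where
  "flux \<gamma> U =
     (dens U * vel U $ 1,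
      (vel U $ 1) *\<^sub>R mom U - (mag U $ 1) *\<^sub>R mag U + ptot \<gamma> U *\<^sub>R e1,
      (vel U $ 1) *\<^sub>R mag U - (mag U $ 1) *\<^sub>R vel U,
      (vel U $ 1) * (ener U + ptot \<gamma> U) - (mag U $ 1) * (vel U \<bullet> mag U))"

definition entropy_generator :: "real \<Rightarrow> (real \<Rightarrow> real) \<Rightarrow> bool" where
  "entropy_generator \<gamma> f \<longleftrightarrow>
     (\<exists>f' f''. (\<forall>x. (f has_real_derivative f' x) (at x)) \<and>
              (\<forall>x. (f' has_real_derivative f'' x) (at x)) \<and>
              continuous_on UNIV f'' \<and>
              (\<forall>x. f' x > 0 \<and> f' x - \<gamma> * f'' x > 0))"

definition spec_entropy :: "real \<Rightarrow> state \<Rightarrow> real" where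
  "spec_entropy \<gamma> U = ln (pres \<gamma> U) - \<gamma> * ln (dens U)"

definition eta :: "real \<Rightarrow> (real \<Rightarrow> real) \<Rightarrow> state \<Rightarrow> real" where
  "eta \<gamma> f U = - dens U * f (spec_entropy \<gamma> U)"

definition eta_flux :: "real \<Rightarrow> (real \<Rightarrow> real) \<Rightarrow> state \<Rightarrow> real" where
  "eta_flux \<gamma> f U = vel U $ 1 * eta \<gamma> f U"


section \<open>Splitting speeds\<close>

definition Cs2 :: "real \<Rightarrow> state \<Rightarrow> real" where
  "Cs2 \<gamma> U = (\<gamma> - 1) * pres \<gamma> U / (2 * dens U)"

definition fast_speed :: "real \<Rightarrow> state \<Rightarrow> real^3 \<Rightarrow> real" where
  "fast_speed \<gamma> U \<xi> =
     1 / sqrt 2 *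
     sqrt (Cs2 \<gamma> U + (norm (mag U))\<^sup>2 / dens U +
           sqrt ((Cs2 \<gamma> U + (norm (mag U))\<^sup>2 / dens U)\<^sup>2
                 - 4 * (Cs2 \<gamma> U * (\<xi> \<bullet> mag U)\<^sup>2 / dens U)))"

definition roe_vel :: "state \<Rightarrow> state \<Rightarrow> real^3" where
  "roe_vel U V =
     (1 / (sqrt (dens U) + sqrt (dens V))) *\<^sub>R
     (sqrt (dens U) *\<^sub>R vel U + sqrt (dens V) *\<^sub>R vel V)"

definition mag_jump :: "state \<Rightarrow> state \<Rightarrow> real" where
  "mag_jump U V = norm (mag U - mag V) / (sqrt (dens U) + sqrt (dens V))"

definition alpha_r :: "real \<Rightarrow> state \<Rightarrow> state \<Rightarrow> real^3 \<Rightarrow> real" where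
  "alpha_r \<gamma> U V \<xi> = max (vel U \<bullet> \<xi>) (roe_vel U V \<bullet> \<xi>) + fast_speed \<gamma> U \<xi> + mag_jump U V"

definition alpha_l :: "real \<Rightarrow> state \<Rightarrow> state \<Rightarrow> real^3 \<Rightarrow> real" where
  "alpha_l \<gamma> U V \<xi> = min (vel U \<bullet> \<xi>) (roe_vel U V \<bullet> \<xi>) - fast_speed \<gamma> U \<xi> - mag_jump U V"

definition alpha_star :: "real \<Rightarrow> state \<Rightarrow> state \<Rightarrow> real^3 \<Rightarrow> real" where
  "alpha_star \<gamma> U V \<xi> = max \<bar>vel U \<bullet> \<xi>\<bar> \<bar>roe_vel U V \<bullet> \<xi>\<bar> + fast_speed \<gamma> U \<xi> + mag_jump U V"


section \<open>HLL flux and intermediate mean\<close>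

text \<open>Both are generic in the conserved quantity, so that they serve for the state with its
  flux as well as for an entropy with its entropy flux. The arguments are \<open>a\<^sup>-, a\<^sup>+\<close>, the left
  and right values of the quantity, and the left and right values of its flux.\<close>

definition hll_flux :: "real \<Rightarrow> real \<Rightarrow> 'a \<Rightarrow> 'a \<Rightarrow> 'a \<Rightarrow> 'a \<Rightarrow> 'a::real_vector" where
  "hll_flux am ap um up fm fp =
     (1 / (ap - am)) *\<^sub>R (ap *\<^sub>R fm - am *\<^sub>R fp + (ap * am) *\<^sub>R (up - um))"

definition hll_mean :: "real \<Rightarrow> real \<Rightarrow> 'a \<Rightarrow> 'a \<Rightarrow> 'a \<Rightarrow> 'a \<Rightarrow> 'a::real_vector" where
  "hll_mean am ap um up fm fp =
     (1 / (ap - am)) *\<^sub>R (ap *\<^sub>R up - am *\<^sub>R um - fp + fm)"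

text \<open>The same for the interior splitting state; here the arguments are \<open>\<beta>\<^sub>L, \<beta>\<^sub>R\<close>.\<close>

definition split_mean :: "real \<Rightarrow> real \<Rightarrow> 'a \<Rightarrow> 'a \<Rightarrow> 'a \<Rightarrow> 'a \<Rightarrow> 'a::real_vector" where
  "split_mean bL bR uL uR fL fR =
     (1 / (bL + bR)) *\<^sub>R (bR *\<^sub>R uR + bL *\<^sub>R uL - fR + fL)"


section \<open>Quadrature, mesh and data\<close>

text \<open>The \<open>L\<close>-point Gauss--Lobatto rule on the reference interval \<open>[-1,1]\<close>, with weights
  normalised to sum 1: both end points are nodes and the rule is exact up to degree \<open>2L - 3\<close>.
  For \<open>L \<ge> 2\<close> this determines nodes and weights uniquely; positivity of the weights and
  \<open>w 1 = w L = 1 / (L (L - 1))\<close> are consequences.\<close>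

definition gauss_lobatto :: "nat \<Rightarrow> (nat \<Rightarrow> real) \<Rightarrow> (nat \<Rightarrow> real) \<Rightarrow> bool" where
  "gauss_lobatto L x w \<longleftrightarrow>
     strict_mono_on {1..L} x \<and> x 1 = -1 \<and> x L = 1 \<and>
     (\<forall>p::real poly. degree p \<le> 2 * L - 3 \<longrightarrow>
        (\<Sum>\<alpha>=1..L. w \<alpha> * poly p (x \<alpha>)) = integral {-1..1} (poly p) / 2)"

text \<open>Vector-valued functions all of whose components are polynomials of degree at most \<open>k\<close>
  on \<open>S\<close>.\<close>

definition poly_on :: "nat \<Rightarrow> real set \<Rightarrow> (real \<Rightarrow> 'a::euclidean_space) \<Rightarrow> bool" where
  "poly_on k S u \<longleftrightarrow>
     (\<forall>b\<in>Basis. \<exists>p::real poly. degree p \<le> k \<and> (\<forall>x\<in>S. u x \<bullet> b = poly p x))"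

text \<open>Cells are numbered \<open>1, \<dots>, ncells\<close>; interface number \<open>i\<close> (\<open>0 \<le> i \<le> ncells\<close>) is
  \<open>x\<^bsub>i+1/2\<^esub>\<close>, so cell \<open>j\<close> lies between the interfaces \<open>j - 1\<close> and \<open>j\<close>.
  The fields \<open>am\<close> and \<open>ap\<close> are the wave speeds \<open>a\<^sup>-, a\<^sup>+\<close> indexed by interfaces, and \<open>node\<close>, \<open>weight\<close>
  are those of the reference quadrature rule.\<close>

record scheme =
  x_left :: real
  dx :: real
  ncells :: nat
  npts :: nat
  node :: "nat \<Rightarrow> real"
  weight :: "nat \<Rightarrow> real"
  sol :: "nat \<Rightarrow> real \<Rightarrow> state"
  ext_left :: state
  ext_right :: state
  am :: "nat \<Rightarrow> real"
  ap :: "nat \<Rightarrow> real"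
  tau :: real

definition xi :: "scheme \<Rightarrow> nat \<Rightarrow> real" where
  "xi S i = x_left S + real i * dx S"

definition cell :: "scheme \<Rightarrow> nat \<Rightarrow> real set" where
  "cell S j = {xi S (j - 1)..xi S j}"

definition cell_node :: "scheme \<Rightarrow> nat \<Rightarrow> nat \<Rightarrow> real" where
  "cell_node S j \<alpha> = xi S (j - 1) + dx S * (node S \<alpha> + 1) / 2"

definition Uhat :: "scheme \<Rightarrow> nat \<Rightarrow> nat \<Rightarrow> state" where
  "Uhat S j \<alpha> = sol S j (cell_node S j \<alpha>)"

definition cell_avg :: "scheme \<Rightarrow> nat \<Rightarrow> state" where
  "cell_avg S j = (1 / dx S) *\<^sub>R integral (cell S j) (sol S j)"

definition UL :: "scheme \<Rightarrow> nat \<Rightarrow> state" where "UL S j = Uhat S j 1"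
definition UR :: "scheme \<Rightarrow> nat \<Rightarrow> state" where "UR S j = Uhat S j (npts S)"

definition Um :: "scheme \<Rightarrow> nat \<Rightarrow> state" where
  "Um S i = (if i = 0 then ext_left S else UR S i)"

definition Up :: "scheme \<Rightarrow> nat \<Rightarrow> state" where
  "Up S i = (if i = ncells S then ext_right S else UL S (i + 1))"

definition alpha_cell :: "real \<Rightarrow> scheme \<Rightarrow> nat \<Rightarrow> real" where
  "alpha_cell \<gamma> S j =
     max (alpha_star \<gamma> (UR S j) (UL S j) e1) (alpha_star \<gamma> (UL S j) (UR S j) e1)"

definition lam :: "scheme \<Rightarrow> real" where "lam S = tau S / dx S"


section \<open>The scheme\<close>

definition num_flux :: "real \<Rightarrow> scheme \<Rightarrow> nat \<Rightarrow> state" where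
  "num_flux \<gamma> S i =
     hll_flux (am S i) (ap S i) (Um S i) (Up S i) (flux \<gamma> (Um S i)) (flux \<gamma> (Up S i))"

definition H_state :: "real \<Rightarrow> scheme \<Rightarrow> nat \<Rightarrow> state" where
  "H_state \<gamma> S i =
     hll_mean (am S i) (ap S i) (Um S i) (Up S i) (flux \<gamma> (Um S i)) (flux \<gamma> (Up S i))"

definition num_eta_flux :: "real \<Rightarrow> (real \<Rightarrow> real) \<Rightarrow> scheme \<Rightarrow> nat \<Rightarrow> real" where
  "num_eta_flux \<gamma> f S i =
     hll_flux (am S i) (ap S i) (eta \<gamma> f (Um S i)) (eta \<gamma> f (Up S i))
       (eta_flux \<gamma> f (Um S i)) (eta_flux \<gamma> f (Up S i))"

definition E_HLL :: "real \<Rightarrow> (real \<Rightarrow> real) \<Rightarrow> scheme \<Rightarrow> nat \<Rightarrow> real" where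
  "E_HLL \<gamma> f S i =
     hll_mean (am S i) (ap S i) (eta \<gamma> f (Um S i)) (eta \<gamma> f (Up S i))
       (eta_flux \<gamma> f (Um S i)) (eta_flux \<gamma> f (Up S i))"

definition beta_L :: "scheme \<Rightarrow> nat \<Rightarrow> real" where
  "beta_L S j = weight S 1 / lam S - ap S (j - 1)"

definition beta_R :: "scheme \<Rightarrow> nat \<Rightarrow> real" where
  "beta_R S j = weight S 1 / lam S + am S j"

definition Xi_state :: "real \<Rightarrow> scheme \<Rightarrow> nat \<Rightarrow> state" where
  "Xi_state \<gamma> S j =
     split_mean (beta_L S j) (beta_R S j) (UL S j) (UR S j) (flux \<gamma> (UL S j)) (flux \<gamma> (UR S j))"

definition E_Xi :: "real \<Rightarrow> (real \<Rightarrow> real) \<Rightarrow> scheme \<Rightarrow> nat \<Rightarrow> real" where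
  "E_Xi \<gamma> f S j =
     split_mean (beta_L S j) (beta_R S j) (eta \<gamma> f (UL S j)) (eta \<gamma> f (UR S j))
       (eta_flux \<gamma> f (UL S j)) (eta_flux \<gamma> f (UR S j))"

definition update :: "real \<Rightarrow> scheme \<Rightarrow> nat \<Rightarrow> state" where
  "update \<gamma> S j = cell_avg S j - lam S *\<^sub>R (num_flux \<gamma> S j - num_flux \<gamma> S (j - 1))"

definition budget :: "real \<Rightarrow> (real \<Rightarrow> real) \<Rightarrow> scheme \<Rightarrow> nat \<Rightarrow> real" where
  "budget \<gamma> f S j =
     (\<Sum>\<alpha>=1..npts S. weight S \<alpha> * eta \<gamma> f (Uhat S j \<alpha>))
     - lam S * (num_eta_flux \<gamma> f S j - num_eta_flux \<gamma> f S (j - 1))"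

definition weakly_multi_entropy_stable ::
  "real \<Rightarrow> real \<Rightarrow> (nat \<Rightarrow> real \<Rightarrow> real) \<Rightarrow> nat \<Rightarrow> nat \<Rightarrow> (nat \<Rightarrow> state) \<Rightarrow>
     (nat \<Rightarrow> nat \<Rightarrow> real) \<Rightarrow> bool" where
  "weakly_multi_entropy_stable \<gamma> b f M N V bud \<longleftrightarrow>
     (\<forall>j\<in>{1..N}. V j \<in> admissible_B b \<and> (\<forall>r\<in>{1..M}. eta \<gamma> (f r) (V j) \<le> bud j r))"

end

(* Substituting the HLL identities F_hat = F(U^-) + a^- (H - U^-) = F(U^+) + a^+ (H - U^+) at the
   two interfaces of a cell turns the update into a convex combination of the interior quadrature
   states, Xi_j and the two states H; the same identities for the entropies give the budget.
   Convexity of eta_r (Jensen) and the assumed entropy inequalities for H and Xi_j then finish.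

   That H and Xi_j are admissible rests on the dual description of the internal energy as the
   minimum over (v, B) of the functionals U |-> gql U v B + |B|^2/2.  The flux contributes a
   symmetric quadratic form in (sqrt(rho) (v_U - v), B_U - B, sqrt(2 e)), e the internal energy,
   whose largest eigenvalue is the fast speed, and a jump term in |B_U - B|^2, controlled by
   mag_jump.  The terms that remain cancel between the two states because their first magnetic
   components agree. *)

theory Submission
  imports Defs
begin

section \<open>Linear functionals dual to the internal energy\<close>

text \<open>The scalar product of \<open>U\<close> with the vector
  \<open>(|v|^2/2, -v, -B, 1)\<close>. With \<open>v\<close> and \<open>B\<close> frozen it is
  linear in the state, so it can be evaluated term by term on means and fluxes.\<close>

definition gql :: "state \<Rightarrow> real^3 \<Rightarrow> real^3 \<Rightarrow> real" where
  "gql U v B = ener U + dens U * (norm v)\<^sup>2 / 2 - mom U \<bullet> v - mag U \<bullet> B"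

lemma gql_linear:
  "gql (U + V) v B = gql U v B + gql V v B"
  "gql (U - V) v B = gql U v B - gql V v B"
  "gql (a *\<^sub>R U) v B = a * gql U v B"
  by (simp_all add: gql_def dens_def mom_def mag_def ener_def inner_simps algebra_simps
      add_divide_distrib diff_divide_distrib)

lemma mom_eq_dens_vel: "dens U > 0 \<Longrightarrow> mom U = dens U *\<^sub>R vel U"
  by (simp add: vel_def)

text \<open>Completing the squares in \<open>v\<close> and \<open>B\<close>. After adding
  \<open>|B|^2/2\<close>, the excess over the internal energy is a sum of squares that vanishes at
  the velocity and field of \<open>U\<close> itself.\<close>

lemma gql_eq_int_energy:
  assumes "dens U > 0"
  shows "gql U v B = int_energy U + dens U * (norm (vel U - v))\<^sup>2 / 2
           + (norm (mag U - B))\<^sup>2 / 2 - (norm B)\<^sup>2 / 2"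
  using assms unfolding gql_def int_energy_def mom_eq_dens_vel[OF assms] power2_norm_eq_inner
  by (simp add: inner_simps inner_commute field_simps)

lemma int_energy_le_gql:
  assumes "dens U > 0"
  shows "int_energy U \<le> gql U v B + (norm B)\<^sup>2 / 2"
  using assms by (simp add: gql_eq_int_energy)

lemma int_energy_eq_gql:
  assumes "dens U > 0"
  shows "int_energy U = gql U (vel U) (mag U) + (norm (mag U))\<^sup>2 / 2"
  using assms by (simp add: gql_eq_int_energy)

text \<open>Pressure and magnetic terms are expressed through the deviations from \<open>v\<close>
  and \<open>B\<close>; the one remaining term, with \<open>v \<bullet> B\<close>, sees
  \<open>U\<close> only through its first magnetic component.\<close>

lemma gql_flux:
  assumes "dens U > 0"
  shows "gql (flux \<gamma> U) v B = vel U $ 1 * gql U v B + ptot \<gamma> U * (vel U $ 1 - v $ 1)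
           - mag U $ 1 * ((vel U - v) \<bullet> (mag U - B)) + mag U $ 1 * (v \<bullet> B)"
  unfolding gql_def flux_def mom_eq_dens_vel[OF assms]
  by (simp add: dens_def[of "(_,_)"] mom_def[of "(_,_)"] mag_def[of "(_,_)"] ener_def[of "(_,_)"]
      e1_def inner_axis inner_axis' inner_simps inner_commute algebra_simps)

section \<open>Admissibility of the HLL mean\<close>

text \<open>The left side is half the quadratic form of a symmetric matrix in
  \<open>(x1, x2, x3, c2, c3, z)\<close>, and \<open>char_eq\<close> says that \<open>C\<close> is
  an eigenvalue of it. The squares below eliminate \<open>z\<close>, \<open>x2\<close>,
  \<open>x3\<close>; a form in \<open>x1\<close> and \<open>(c2, c3)\<close> with coefficients
  \<open>P\<close>, \<open>Q\<close>, \<open>R\<close> remains.\<close>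

lemma symmetric_form_bound:
  fixes C s :: real
  assumes C: "C > 0" and s: "s\<^sup>2 \<le> C\<^sup>2" and b1: "b1\<^sup>2 \<le> C\<^sup>2"
    and char_eq: "(C\<^sup>2 - s\<^sup>2) * (C\<^sup>2 - b1\<^sup>2) = C\<^sup>2 * (b2\<^sup>2 + b3\<^sup>2)"
  shows "s * x1 * z + x1 * (b2 * c2 + b3 * c3) - b1 * (x2 * c2 + x3 * c3)
           \<le> C / 2 * (x1\<^sup>2 + x2\<^sup>2 + x3\<^sup>2 + c2\<^sup>2 + c3\<^sup>2 + z\<^sup>2)"
proof -
  define P where "P = (C\<^sup>2 - s\<^sup>2) * x1\<^sup>2"
  define Q where "Q = (C\<^sup>2 - b1\<^sup>2) * (c2\<^sup>2 + c3\<^sup>2)"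
  define R where "R = C * x1 * (b2 * c2 + b3 * c3)"
  have P: "P \<ge> 0" and Q: "Q \<ge> 0" using s b1 by (simp_all add: P_def Q_def)
  have "(b2 * c2 + b3 * c3)\<^sup>2 \<le> (b2\<^sup>2 + b3\<^sup>2) * (c2\<^sup>2 + c3\<^sup>2)"
    using zero_le_power2[of "b2 * c3 - b3 * c2"] by (simp add: power2_eq_square algebra_simps)
  then have "R\<^sup>2 \<le> C\<^sup>2 * x1\<^sup>2 * ((b2\<^sup>2 + b3\<^sup>2) * (c2\<^sup>2 + c3\<^sup>2))"
    unfolding R_def power_mult_distrib by (intro mult_left_mono) auto
  \<comment> \<open>Here \<open>char_eq\<close> enters: it makes the bound for \<open>R^2\<close>
    exactly \<open>P * Q\<close>, so the arithmetic-geometric mean inequality closes the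
    estimate.\<close>
  also have "\<dots> = (C\<^sup>2 * (b2\<^sup>2 + b3\<^sup>2)) * x1\<^sup>2 * (c2\<^sup>2 + c3\<^sup>2)" by simp
  also have "\<dots> = P * Q" unfolding char_eq[symmetric] P_def Q_def by simp
  finally have "R\<^sup>2 \<le> P * Q" .
  then have "\<bar>R\<bar> \<le> sqrt (P * Q)" using real_le_rsqrt by force
  also have "\<dots> \<le> (P + Q) / 2" using arith_geo_mean_sqrt[OF P Q] .
  finally have PQR: "0 \<le> P + Q - 2 * R" by simp
  have "2 * C * (C / 2 * (x1\<^sup>2 + x2\<^sup>2 + x3\<^sup>2 + c2\<^sup>2 + c3\<^sup>2 + z\<^sup>2)
          - (s * x1 * z + x1 * (b2 * c2 + b3 * c3) - b1 * (x2 * c2 + x3 * c3)))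
        = (C * z - s * x1)\<^sup>2 + (C * x2 + b1 * c2)\<^sup>2 + (C * x3 + b1 * c3)\<^sup>2 + (P + Q - 2 * R)"
    unfolding P_def Q_def R_def by (simp add: power2_eq_square algebra_simps)
  also have "\<dots> \<ge> 0" by (intro add_nonneg_nonneg PQR) auto
  finally show ?thesis using C by (simp add: zero_le_mult_iff)
qed

text \<open>With \<open>k\<close>, \<open>p\<close>, \<open>q\<close> as below, \<open>C^2\<close>
  is the larger root of \<open>t^2 - (k + p + q) t + k p\<close>, and this equation rearranges to
  \<open>(t - k) (t - p) = t q\<close>.\<close>

lemma fast_speed_char:
  assumes "\<gamma> > 1" and U: "U \<in> admissible"
  defines "C \<equiv> fast_speed \<gamma> U e1"
  shows "C > 0" "Cs2 \<gamma> U > 0" "Cs2 \<gamma> U \<le> C\<^sup>2" "(mag U $ 1)\<^sup>2 / dens U \<le> C\<^sup>2"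
    and "(C\<^sup>2 - Cs2 \<gamma> U) * (C\<^sup>2 - (mag U $ 1)\<^sup>2 / dens U)
           = C\<^sup>2 * ((mag U $ 2)\<^sup>2 / dens U + (mag U $ 3)\<^sup>2 / dens U)"
proof -
  define k where "k = Cs2 \<gamma> U"
  define p where "p = (mag U $ 1)\<^sup>2 / dens U"
  define q where "q = (mag U $ 2)\<^sup>2 / dens U + (mag U $ 3)\<^sup>2 / dens U"
  have dens: "dens U > 0" and "int_energy U > 0" using U by (auto simp: admissible_def)
  then show k0: "Cs2 \<gamma> U > 0" using assms(1) by (simp add: Cs2_def pres_def)
  have p0: "p \<ge> 0" and q0: "q \<ge> 0" using dens by (simp_all add: p_def q_def)
  have pq: "(norm (mag U))\<^sup>2 / dens U = p + q"
    unfolding power2_norm_eq_inner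
    by (simp add: p_def q_def inner_vec_def sum_3 power2_eq_square add_divide_distrib)
  have e1p: "Cs2 \<gamma> U * (e1 \<bullet> mag U)\<^sup>2 / dens U = k * p"
    by (simp add: e1_def inner_axis' k_def p_def)
  define d where "d = sqrt ((k + (p + q))\<^sup>2 - 4 * (k * p))"
  have C: "C = 1 / sqrt 2 * sqrt (k + (p + q) + d)"
    unfolding C_def fast_speed_def pq e1p d_def by (simp add: k_def)
  \<comment> \<open>This form bounds the discriminant below by \<open>(k - p)^2\<close>; hence
    \<open>d\<close> is a real root and \<open>C^2\<close> is at least both \<open>k\<close> and
    \<open>p\<close>.\<close>
  have disc: "(k + (p + q))\<^sup>2 - 4 * (k * p) = (k - p)\<^sup>2 + q * (q + 2 * k + 2 * p)"
    by (simp add: power2_eq_square algebra_simps)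
  have k': "k > 0" using k0 by (simp add: k_def)
  have disc_ge: "(k - p)\<^sup>2 \<le> (k + (p + q))\<^sup>2 - 4 * (k * p)"
    unfolding disc using k' p0 q0 by simp
  have d2: "d\<^sup>2 = (k + (p + q))\<^sup>2 - 4 * (k * p)"
    unfolding d_def by (rule real_sqrt_pow2) (use disc_ge order_trans[OF zero_le_power2] in blast)
  have d_ge: "d \<ge> \<bar>k - p\<bar>"
    unfolding d_def using disc_ge by (metis real_sqrt_abs real_sqrt_le_iff)
  have pos: "k + (p + q) + d > 0" using k' p0 q0 d_ge by linarith
  then show "C > 0" by (simp add: C)
  have C2: "C\<^sup>2 = (k + (p + q) + d) / 2"
    using pos by (simp add: C power_mult_distrib power_divide)
  show "Cs2 \<gamma> U \<le> C\<^sup>2" "(mag U $ 1)\<^sup>2 / dens U \<le> C\<^sup>2"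
    using d_ge q0 unfolding C2 k_def[symmetric] p_def[symmetric] by (simp_all add: abs_le_iff)
  have "(C\<^sup>2 - k) * (C\<^sup>2 - p) - C\<^sup>2 * q = (d\<^sup>2 - ((k + (p + q))\<^sup>2 - 4 * (k * p))) / 4"
    unfolding C2 by (simp add: power2_eq_square field_simps)
  then show "(C\<^sup>2 - Cs2 \<gamma> U) * (C\<^sup>2 - (mag U $ 1)\<^sup>2 / dens U)
           = C\<^sup>2 * ((mag U $ 2)\<^sup>2 / dens U + (mag U $ 3)\<^sup>2 / dens U)"
    using d2 unfolding k_def p_def q_def by simp
qed

text \<open>An instance of \<open>symmetric_form_bound\<close> with
  \<open>x = sqrt \<rho> u\<close>, \<open>z = sqrt (2 e)\<close>, \<open>s = sqrt Cs2\<close> and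
  \<open>b = B / sqrt \<rho>\<close>. The factor 1/2 in \<open>Cs2\<close> is what makes
  \<open>s * sqrt \<rho> * z\<close> equal to the pressure.\<close>

lemma fast_speed_bound:
  fixes u c :: "real^3"
  assumes "\<gamma> > 1" and U: "U \<in> admissible"
  shows "\<bar>pres \<gamma> U * u $ 1 + u $ 1 * (c \<bullet> mag U) - mag U $ 1 * (u \<bullet> c)\<bar>
    \<le> fast_speed \<gamma> U e1 * (int_energy U + dens U * (norm u)\<^sup>2 / 2 + (norm c)\<^sup>2 / 2)"
proof -
  note ch = fast_speed_char[OF assms]
  let ?r = "sqrt (dens U)" and ?B = "mag U" and ?C = "fast_speed \<gamma> U e1"
  have dens: "dens U > 0" and ie: "int_energy U > 0" using U by (auto simp: admissible_def)
  have sq: "(y / ?r)\<^sup>2 = y\<^sup>2 / dens U" for y using dens by (simp add: power_divide)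
  have "sqrt (Cs2 \<gamma> U) * ?r * sqrt (2 * int_energy U) = sqrt (Cs2 \<gamma> U * dens U * (2 * int_energy U))"
    by (simp add: real_sqrt_mult)
  also have "\<dots> = sqrt ((pres \<gamma> U)\<^sup>2)"
    using dens by (intro arg_cong[where f = sqrt]) (simp add: Cs2_def pres_def power2_eq_square)
  finally have press: "sqrt (Cs2 \<gamma> U) * ?r * sqrt (2 * int_energy U) = pres \<gamma> U"
    using ie assms(1) by (simp add: pres_def)
  have *: "pres \<gamma> U * w $ 1 + w $ 1 * (c \<bullet> mag U) - mag U $ 1 * (w \<bullet> c)
      \<le> ?C * (int_energy U + dens U * (norm w)\<^sup>2 / 2 + (norm c)\<^sup>2 / 2)" for w
  proof -
    have "sqrt (Cs2 \<gamma> U) * (?r * w $ 1) * sqrt (2 * int_energy U)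
        + ?r * w $ 1 * (?B $ 2 / ?r * c $ 2 + ?B $ 3 / ?r * c $ 3)
        - ?B $ 1 / ?r * (?r * w $ 2 * c $ 2 + ?r * w $ 3 * c $ 3)
      \<le> ?C / 2 * ((?r * w $ 1)\<^sup>2 + (?r * w $ 2)\<^sup>2 + (?r * w $ 3)\<^sup>2 + (c $ 2)\<^sup>2 + (c $ 3)\<^sup>2
           + (sqrt (2 * int_energy U))\<^sup>2)"
      by (rule symmetric_form_bound) (use ch in \<open>simp_all add: sq\<close>)
    also have "sqrt (Cs2 \<gamma> U) * (?r * w $ 1) * sqrt (2 * int_energy U) = pres \<gamma> U * w $ 1"
      unfolding press[symmetric] by simp
    also have "?r * w $ 1 * (?B $ 2 / ?r * c $ 2 + ?B $ 3 / ?r * c $ 3)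
        = w $ 1 * (?B $ 2 * c $ 2 + ?B $ 3 * c $ 3)"
      using dens by (simp add: field_simps)
    also have "?B $ 1 / ?r * (?r * w $ 2 * c $ 2 + ?r * w $ 3 * c $ 3)
        = ?B $ 1 * (w $ 2 * c $ 2 + w $ 3 * c $ 3)"
      using dens by (simp add: field_simps)
    \<comment> \<open>The first component of \<open>c\<close> cancels on the left, so its square is
      merely added on the right.\<close>
    also have "?C / 2 * ((?r * w $ 1)\<^sup>2 + (?r * w $ 2)\<^sup>2 + (?r * w $ 3)\<^sup>2 + (c $ 2)\<^sup>2 + (c $ 3)\<^sup>2
           + (sqrt (2 * int_energy U))\<^sup>2)
         \<le> ?C / 2 * (dens U * (norm w)\<^sup>2 + (norm c)\<^sup>2 + 2 * int_energy U)"
      using dens ie ch(1)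
      by (intro mult_left_mono)
        (simp_all add: power_mult_distrib power2_norm_eq_inner inner_vec_def sum_3
          power2_eq_square[symmetric] algebra_simps)
    finally show ?thesis
      by (simp add: inner_vec_def sum_3 algebra_simps)
  qed
  from *[of u] *[of "- u"] show ?thesis by (simp add: abs_le_iff)
qed

text \<open>The weight \<open>\<surd>\<rho>\<close> in the averaged velocity is what lets the jump of \<open>|B - B\<^sup>*|\<^sup>2\<close>, transported
  with that velocity, be absorbed into the energies of both states.\<close>

lemma mag_jump_bound:
  fixes v B :: "real^3"
  assumes dens: "dens U > 0" "dens V > 0"
  shows "\<bar>(roe_vel U V $ 1 - v $ 1) * ((norm (mag U - B))\<^sup>2 - (norm (mag V - B))\<^sup>2) / 2\<bar>
    \<le> mag_jump U V * (dens U * (norm (vel U - v))\<^sup>2 / 2 + (norm (mag U - B))\<^sup>2 / 2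
       + (dens V * (norm (vel V - v))\<^sup>2 / 2 + (norm (mag V - B))\<^sup>2 / 2))"
proof -
  define r where "r = sqrt (dens U)"
  define t where "t = sqrt (dens V)"
  define c where "c = mag U - B"
  define d where "d = mag V - B"
  have r: "r > 0" "r\<^sup>2 = dens U" and t: "t > 0" "t\<^sup>2 = dens V"
    using dens by (simp_all add: r_def t_def)
  let ?x = "\<bar>r * (vel U - v) $ 1\<bar>" and ?y = "\<bar>t * (vel V - v) $ 1\<bar>"
  \<comment> \<open>The averaging weights produce square roots of the directional kinetic energies
    over the same denominator as in \<open>mag_jump\<close>.\<close>
  have "roe_vel U V $ 1 - v $ 1 = (r * (vel U - v) $ 1 + t * (vel V - v) $ 1) / (r + t)"
    using r t add_pos_pos[of r t] unfolding roe_vel_def r_def[symmetric] t_def[symmetric]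
    by (simp add: divide_simps) (simp add: algebra_simps)
  then have 1: "\<bar>roe_vel U V $ 1 - v $ 1\<bar> \<le> (?x + ?y) / (r + t)"
    using r t by (simp add: abs_divide divide_right_mono)
  have "(norm c)\<^sup>2 - (norm d)\<^sup>2 = (c - d) \<bullet> (c + d)"
    by (simp add: power2_norm_eq_inner inner_simps inner_commute)
  also have "\<bar>\<dots>\<bar> \<le> norm (c - d) * norm (c + d)" by (rule Cauchy_Schwarz_ineq2)
  also have "\<dots> \<le> norm (c - d) * (norm c + norm d)"
    by (intro mult_left_mono norm_triangle_ineq) auto
  finally have 2: "\<bar>(norm c)\<^sup>2 - (norm d)\<^sup>2\<bar> \<le> norm (mag U - mag V) * (norm c + norm d)"
    by (simp add: c_def d_def)
  have "\<bar>(roe_vel U V $ 1 - v $ 1) * ((norm c)\<^sup>2 - (norm d)\<^sup>2) / 2\<bar>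
      = \<bar>roe_vel U V $ 1 - v $ 1\<bar> * \<bar>(norm c)\<^sup>2 - (norm d)\<^sup>2\<bar> / 2"
    by (simp add: abs_mult)
  also have "\<dots> \<le> ((?x + ?y) / (r + t)) * (norm (mag U - mag V) * (norm c + norm d)) / 2"
    using r t by (intro divide_right_mono mult_mono 1 2) auto
  also have "\<dots> = mag_jump U V * ((?x + ?y) * (norm c + norm d) / 2)"
    by (simp add: mag_jump_def r_def t_def)
  also have "\<dots> \<le> mag_jump U V * ((?x\<^sup>2 + ?y\<^sup>2 + (norm c)\<^sup>2 + (norm d)\<^sup>2) / 2)"
  proof (intro mult_left_mono divide_right_mono)
    \<comment> \<open>This sum of squares is twice the difference of the two sides.\<close>
    have "0 \<le> (?x - ?y)\<^sup>2 + (norm c - norm d)\<^sup>2 + (?x + ?y - norm c - norm d)\<^sup>2" by simp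
    then show "(?x + ?y) * (norm c + norm d) \<le> ?x\<^sup>2 + ?y\<^sup>2 + (norm c)\<^sup>2 + (norm d)\<^sup>2"
      unfolding power2_eq_square by (simp only: algebra_simps)
  qed (use dens in \<open>auto simp: mag_jump_def\<close>)
  also have "\<dots> \<le> mag_jump U V * ((dens U * (norm (vel U - v))\<^sup>2 + dens V * (norm (vel V - v))\<^sup>2
      + (norm c)\<^sup>2 + (norm d)\<^sup>2) / 2)"
  proof (intro mult_left_mono divide_right_mono add_mono order_refl)
    have sq: "(w $ 1)\<^sup>2 \<le> (norm w)\<^sup>2" for w :: "real^3"
      using component_le_norm_cart[of w 1] by (metis abs_ge_zero power2_abs power_mono)
    show "?x\<^sup>2 \<le> dens U * (norm (vel U - v))\<^sup>2" "?y\<^sup>2 \<le> dens V * (norm (vel V - v))\<^sup>2"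
      using sq dens by (simp_all only: power2_abs power_mult_distrib r t mult_left_mono less_imp_le)
  qed (use dens in \<open>auto simp: mag_jump_def\<close>)
  finally show ?thesis by (simp add: c_def d_def add_divide_distrib algebra_simps)
qed

text \<open>The terms are grouped by what controls them: the hydrodynamic energy moves with
  \<open>vel U\<close>, the magnetic deviation only with \<open>v\<close>, the bracket is the form
  of \<open>fast_speed_bound\<close>, and the last group depends on \<open>U\<close> through
  \<open>mag U $ 1\<close> alone.\<close>

lemma gql_excess:
  assumes "dens U > 0"
  shows "a * (gql U v B + (norm B)\<^sup>2 / 2) - gql (flux \<gamma> U) v B
    = (a - vel U $ 1) * (int_energy U + dens U * (norm (vel U - v))\<^sup>2 / 2)
      + (a - v $ 1) * ((norm (mag U - B))\<^sup>2 / 2)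
      - (pres \<gamma> U * (vel U - v) $ 1 + (vel U - v) $ 1 * ((mag U - B) \<bullet> mag U)
           - mag U $ 1 * ((vel U - v) \<bullet> (mag U - B)))
      + (v $ 1 * ((norm B)\<^sup>2 / 2) - mag U $ 1 * (v \<bullet> B))"
proof -
  have sq: "(norm (mag U))\<^sup>2 = 2 * ((mag U - B) \<bullet> mag U) - (norm (mag U - B))\<^sup>2 + (norm B)\<^sup>2"
    by (simp add: power2_norm_eq_inner inner_simps inner_commute)
  then show ?thesis
    unfolding gql_flux[OF assms] gql_eq_int_energy[OF assms] ptot_def sq vector_minus_component
    by (simp add: field_simps)
qed

section \<open>Symmetry, linearity and the positivity of the HLL mean\<close>

lemma roe_vel_commute: "roe_vel U V = roe_vel V U"
  by (simp add: roe_vel_def add.commute)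

lemma mag_jump_commute: "mag_jump U V = mag_jump V U"
  by (simp add: mag_jump_def add.commute norm_minus_commute)

lemma dens_flux: "dens (flux \<gamma> U) = vel U $ 1 * dens U"
  by (simp add: flux_def dens_def)

lemma mag1_flux: "mag (flux \<gamma> U) $ 1 = 0"
  by (simp add: flux_def mag_def)

lemma dens_linear: "dens (U + V) = dens U + dens V" "dens (U - V) = dens U - dens V"
  "dens (a *\<^sub>R U) = a * dens U"
  by (simp_all add: dens_def)

lemma mag_linear: "mag (U + V) = mag U + mag V" "mag (U - V) = mag U - mag V"
  "mag (a *\<^sub>R U) = a *\<^sub>R mag U"
  by (simp_all add: mag_def)

lemma mag_jump_nonneg: "dens U > 0 \<Longrightarrow> dens V > 0 \<Longrightarrow> mag_jump U V \<ge> 0"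
  by (simp add: mag_jump_def)

lemma admissible_B_D:
  assumes "U \<in> admissible_B b"
  shows "dens U > 0" "int_energy U > 0" "mag U $ 1 = b" "U \<in> admissible"
  using assms by (auto simp: admissible_B_def admissible_def)

text \<open>Each speed leaves a margin beyond the velocities: the fast speeds \<open>C\<close>,
  \<open>D\<close> pay for the quadratic forms, and \<open>\<beta>\<close> pays for the jump term.
  The same statement later covers the interior splitting state.\<close>

lemma hll_mean_admissible:
  assumes gamma: "\<gamma> > 1"
    and U: "U \<in> admissible_B b" and V: "V \<in> admissible_B b"
    and r: "alpha_r \<gamma> V U e1 < r" and l: "l < alpha_l \<gamma> U V e1"
  shows "l < r" "hll_mean l r U V (flux \<gamma> U) (flux \<gamma> V) \<in> admissible_B b"
proof -
  note [simp] = admissible_B_D[OF U] admissible_B_D[OF V]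
  have e1: "w \<bullet> e1 = w $ 1" for w :: "real^3" by (simp add: e1_def inner_axis)
  define w where "w = roe_vel U V $ 1"
  define \<beta> where "\<beta> = mag_jump U V"
  define C where "C = fast_speed \<gamma> U e1"
  define D where "D = fast_speed \<gamma> V e1"
  have \<beta>: "\<beta> \<ge> 0" unfolding \<beta>_def by (rule mag_jump_nonneg) simp_all
  have CD: "C > 0" "D > 0" using gamma by (simp_all add: C_def D_def fast_speed_char)
  have r': "r > max (vel V $ 1) w + D + \<beta>"
    using r by (simp add: alpha_r_def e1 roe_vel_commute[of V] mag_jump_commute[of V] w_def \<beta>_def D_def)
  have l': "l < min (vel U $ 1) w - C - \<beta>"
    using l by (simp add: alpha_l_def e1 w_def \<beta>_def C_def)
  show "l < r" using r' l' CD \<beta> by linarith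
  define W where "W = hll_mean l r U V (flux \<gamma> U) (flux \<gamma> V)"
  have W: "(r - l) *\<^sub>R W = r *\<^sub>R V - flux \<gamma> V - (l *\<^sub>R U - flux \<gamma> U)"
    unfolding W_def hll_mean_def using \<open>l < r\<close> by (simp del: scaleR_right_diff_distrib)
  have "(r - l) * dens W = dens ((r - l) *\<^sub>R W)" by (simp add: dens_linear)
  also have "\<dots> = (r - vel V $ 1) * dens V + (vel U $ 1 - l) * dens U"
    unfolding W by (simp add: dens_linear dens_flux algebra_simps)
  also have "\<dots> > 0" using r' l' CD \<beta> by (intro add_pos_pos mult_pos_pos) auto
  finally have dW: "dens W > 0" using \<open>l < r\<close> by (simp add: zero_less_mult_iff)
  have "(r - l) * mag W $ 1 = mag ((r - l) *\<^sub>R W) $ 1" by (simp add: mag_linear)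
  also have "\<dots> = (r - l) * b"
    unfolding W by (simp add: mag_linear mag1_flux algebra_simps)
  finally have bW: "mag W $ 1 = b" using \<open>l < r\<close> by simp
  \<comment> \<open>These parameters are optimal for the mean \<open>W\<close>, so the functional
    returns its internal energy exactly.\<close>
  define v where "v = vel W"
  define B where "B = mag W"
  define kU where "kU = int_energy U + dens U * (norm (vel U - v))\<^sup>2 / 2"
  define kV where "kV = int_energy V + dens V * (norm (vel V - v))\<^sup>2 / 2"
  define mU where "mU = (norm (mag U - B))\<^sup>2 / 2"
  define mV where "mV = (norm (mag V - B))\<^sup>2 / 2"
  define fU where "fU = pres \<gamma> U * (vel U - v) $ 1 + (vel U - v) $ 1 * ((mag U - B) \<bullet> mag U)
           - mag U $ 1 * ((vel U - v) \<bullet> (mag U - B))"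
  define fV where "fV = pres \<gamma> V * (vel V - v) $ 1 + (vel V - v) $ 1 * ((mag V - B) \<bullet> mag V)
           - mag V $ 1 * ((vel V - v) \<bullet> (mag V - B))"
  have kpos: "kU > 0" "kV > 0" unfolding kU_def kV_def by (auto intro!: add_pos_nonneg simp: less_imp_le)
  have mpos: "mU \<ge> 0" "mV \<ge> 0" by (simp_all add: mU_def mV_def)
  have fU: "\<bar>fU\<bar> \<le> C * (kU + mU)"
    unfolding fU_def C_def kU_def mU_def by (rule fast_speed_bound) (use gamma in simp_all)
  have fV: "\<bar>fV\<bar> \<le> D * (kV + mV)"
    unfolding fV_def D_def kV_def mV_def by (rule fast_speed_bound) (use gamma in simp_all)
  have "\<bar>(w - v $ 1) * (mU - mV)\<bar> \<le> \<beta> * (kU - int_energy U + mU + (kV - int_energy V + mV))"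
    using mag_jump_bound[of U V v B] unfolding w_def \<beta>_def mU_def mV_def kU_def kV_def
    by (simp add: diff_divide_distrib[symmetric])
  also have "\<dots> \<le> \<beta> * (kU + mU + (kV + mV))"
    using admissible_B_D(2)[OF U] admissible_B_D(2)[OF V] by (intro mult_left_mono \<beta>) linarith
  finally have jump: "\<bar>(w - v $ 1) * (mU - mV)\<bar> \<le> \<beta> * (kU + mU + (kV + mV))" .
  have "(r - l) * int_energy W = gql ((r - l) *\<^sub>R W) v B + (r - l) * ((norm B)\<^sup>2 / 2)"
    by (simp add: int_energy_eq_gql[OF dW] v_def B_def gql_linear algebra_simps)
  also have "\<dots> = (r * (gql V v B + (norm B)\<^sup>2 / 2) - gql (flux \<gamma> V) v B)
      - (l * (gql U v B + (norm B)\<^sup>2 / 2) - gql (flux \<gamma> U) v B)"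
    unfolding W by (simp add: gql_linear field_simps)
  \<comment> \<open>The last groups of the two excesses cancel, both states having first magnetic
    component \<open>b\<close>.\<close>
  also have "\<dots> = (r - vel V $ 1) * kV + (r - v $ 1) * mV - fV
      - ((l - vel U $ 1) * kU + (l - v $ 1) * mU - fU)"
    unfolding gql_excess[OF admissible_B_D(1)[OF U]] gql_excess[OF admissible_B_D(1)[OF V]]
      kU_def[symmetric] kV_def[symmetric] mU_def[symmetric] mV_def[symmetric]
      fU_def[symmetric] fV_def[symmetric] by simp
  \<comment> \<open>The speeds give no direct control of \<open>v\<close>; it is exchanged for the
    averaged velocity \<open>w\<close> at the price of one jump term.\<close>
  also have "\<dots> = (r - vel V $ 1) * kV + (r - w) * mV + (vel U $ 1 - l) * kU + (w - l) * mU
      - (w - v $ 1) * (mU - mV) - fV + fU"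
    by (simp add: algebra_simps)
  also have "\<dots> > 0"
  proof -
    have "(r - vel V $ 1) * kV > (D + \<beta>) * kV" "(vel U $ 1 - l) * kU > (C + \<beta>) * kU"
      using r' l' kpos by (auto intro!: mult_strict_right_mono)
    moreover have "(r - w) * mV \<ge> (D + \<beta>) * mV" "(w - l) * mU \<ge> (C + \<beta>) * mU"
      using r' l' mpos by (auto intro!: mult_right_mono)
    ultimately show ?thesis using fU fV jump by (simp add: algebra_simps abs_le_iff)
  qed
  finally have "int_energy W > 0" using \<open>l < r\<close> by (simp add: zero_less_mult_iff)
  then show "hll_mean l r U V (flux \<gamma> U) (flux \<gamma> V) \<in> admissible_B b"
    using dW bW by (simp add: W_def admissible_B_def admissible_def)
qed

section \<open>Convexity of the entropies\<close>

text \<open>The second derivative is \<open>\<gamma> (f' - \<gamma> f'') / w^2\<close>: one sign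
  condition on the generator gives convexity, the other monotonicity.\<close>

lemma entropy_profile_convex:
  assumes gamma: "\<gamma> > 1" and f: "entropy_generator \<gamma> f"
  shows "convex_on {0<..} (\<lambda>w. - f (\<gamma> * ln w + c))"
    and "\<And>w z. 0 < w \<Longrightarrow> w \<le> z \<Longrightarrow> - f (\<gamma> * ln z + c) \<le> - f (\<gamma> * ln w + c)"
proof -
  obtain f' f'' where f': "\<And>x. (f has_real_derivative f' x) (at x)"
    and f'': "\<And>x. (f' has_real_derivative f'' x) (at x)"
    and pos: "\<And>x. f' x > 0" "\<And>x. f' x - \<gamma> * f'' x > 0"
    using f unfolding entropy_generator_def by blast
  note [derivative_intros] = DERIV_chain2[OF f'] DERIV_chain2[OF f'']
  show "convex_on {0<..} (\<lambda>w. - f (\<gamma> * ln w + c))"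
  proof (rule f''_ge0_imp_convex)
    fix w :: real assume w: "w \<in> {0<..}"
    then show "((\<lambda>w. - f (\<gamma> * ln w + c)) has_real_derivative - f' (\<gamma> * ln w + c) * \<gamma> / w) (at w)"
      by (auto intro!: derivative_eq_intros)
    show "((\<lambda>w. - f' (\<gamma> * ln w + c) * \<gamma> / w) has_real_derivative
        \<gamma> * (f' (\<gamma> * ln w + c) - \<gamma> * f'' (\<gamma> * ln w + c)) / w\<^sup>2) (at w)"
      using w by (auto intro!: derivative_eq_intros simp: field_simps power2_eq_square)
    show "0 \<le> \<gamma> * (f' (\<gamma> * ln w + c) - \<gamma> * f'' (\<gamma> * ln w + c)) / w\<^sup>2"
      using gamma pos(2)[of "\<gamma> * ln w + c"] by simp
  qed auto
  have "mono f"
    using DERIV_nonneg_imp_nondecreasing f' pos(1) by (metis less_imp_le monoI)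
  then show "- f (\<gamma> * ln z + c) \<le> - f (\<gamma> * ln w + c)" if "0 < w" "w \<le> z" for w z
    using that gamma by (simp add: monoD)
qed

lemma concave_powr:
  assumes "0 \<le> p" "p \<le> 1"
  shows "convex_on {0<..} (\<lambda>x::real. - (x powr p))"
proof (rule f''_ge0_imp_convex)
  fix x :: real assume x: "x \<in> {0<..}"
  then show "((\<lambda>x. - (x powr p)) has_real_derivative - (p * x powr (p - 1))) (at x)"
    by (auto intro!: derivative_eq_intros)
  show "((\<lambda>x. - (p * x powr (p - 1))) has_real_derivative p * (1 - p) * x powr (p - 2)) (at x)"
    using x by (auto intro!: derivative_eq_intros simp: algebra_simps)
  show "0 \<le> p * (1 - p) * x powr (p - 2)" using assms by simp
qed auto

text \<open>A minimum of affine functionals is concave: both states are tested with the parameters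
  optimal for \<open>W\<close>.\<close>

lemma int_energy_concave:
  assumes U: "dens U > 0" and V: "dens V > 0" and "0 < t" "t < 1"
  defines "W \<equiv> (1 - t) *\<^sub>R U + t *\<^sub>R V"
  shows "dens W > 0" "(1 - t) * int_energy U + t * int_energy V \<le> int_energy W"
proof -
  show W: "dens W > 0"
    unfolding W_def dens_linear using assms by (intro add_pos_pos mult_pos_pos) auto
  have "(1 - t) * int_energy U + t * int_energy V
      \<le> (1 - t) * (gql U (vel W) (mag W) + (norm (mag W))\<^sup>2 / 2)
        + t * (gql V (vel W) (mag W) + (norm (mag W))\<^sup>2 / 2)"
    using assms by (intro add_mono mult_left_mono int_energy_le_gql) auto
  also have "\<dots> = int_energy W"
    unfolding int_energy_eq_gql[OF W] unfolding W_def gql_linear by (simp add: field_simps)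
  finally show "(1 - t) * int_energy U + t * int_energy V \<le> int_energy W" .
qed

lemma convex_admissible: "convex admissible"
proof -
  have "(1 - t) *\<^sub>R U + t *\<^sub>R V \<in> admissible"
    if "U \<in> admissible" "V \<in> admissible" "0 < t" "t < 1" for U V t
  proof -
    have "0 < (1 - t) * int_energy U + t * int_energy V"
      using that by (auto simp: admissible_def intro!: add_pos_pos)
    then show ?thesis
      using that int_energy_concave[of U V t] by (auto simp: admissible_def)
  qed
  then show ?thesis
    unfolding convex_alt
    by (metis (no_types, opaque_lifting) add.left_neutral add.right_neutral diff_zero diff_self
        less_eq_real_def scale_one scale_zero_left)
qed

lemma convex_admissible_B: "convex (admissible_B b)"
proof -
  have "admissible_B b = admissible \<inter> {U. mag U $ 1 = b}"
    by (auto simp: admissible_B_def)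
  moreover have "convex {U. mag U $ 1 = b}"
    by (auto simp: convex_def mag_linear simp flip: distrib_right)
  ultimately show ?thesis by (simp add: convex_Int convex_admissible)
qed

text \<open>Taking the root \<open>1 / \<gamma>\<close> of the internal energy lets
  \<open>\<gamma>\<close> be factored out of both logarithms, so that only a ratio to the density
  remains.\<close>

lemma eta_perspective:
  assumes "\<gamma> > 1" and U: "U \<in> admissible"
  shows "eta \<gamma> f U
    = dens U * - f (\<gamma> * ln (int_energy U powr (1 / \<gamma>) / dens U) + ln (\<gamma> - 1))"
proof -
  have "dens U > 0" "int_energy U > 0" using U by (auto simp: admissible_def)
  then have "spec_entropy \<gamma> U = \<gamma> * ln (int_energy U powr (1 / \<gamma>) / dens U) + ln (\<gamma> - 1)"
    using assms(1) by (simp add: spec_entropy_def pres_def ln_mult ln_div ln_powr right_diff_distrib)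
  then show ?thesis by (simp add: eta_def)
qed

text \<open>By \<open>eta_perspective\<close>, \<open>\<eta>\<close> is the perspective \<open>\<rho> k(\<sigma> / \<rho>)\<close> of the decreasing convex
  function \<open>k(w) = - f (\<gamma> ln w + ln (\<gamma> - 1))\<close>, with \<open>\<sigma>\<close>, a root of the internal energy,
  concave in the state.\<close>

lemma eta_convex:
  assumes gamma: "\<gamma> > 1" and f: "entropy_generator \<gamma> f"
  shows "convex_on admissible (eta \<gamma> f)"
proof (rule convex_onI)
  fix t :: real and U V
  assume t: "0 < t" "t < 1" and UV: "U \<in> admissible" "V \<in> admissible"
  define W where "W = (1 - t) *\<^sub>R U + t *\<^sub>R V"
  define k where "k w = - f (\<gamma> * ln w + ln (\<gamma> - 1))" for w
  define \<sigma> where "\<sigma> X = int_energy X powr (1 / \<gamma>)" for X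
  note k_convex = entropy_profile_convex(1)[OF gamma f, of "ln (\<gamma> - 1)", folded k_def]
  note k_mono = entropy_profile_convex(2)[OF gamma f, of _ _ "ln (\<gamma> - 1)", folded k_def]
  have pos: "dens U > 0" "int_energy U > 0" "dens V > 0" "int_energy V > 0"
    using UV by (auto simp: admissible_def)
  have eta: "eta \<gamma> f X = dens X * k (\<sigma> X / dens X)" if "X \<in> admissible" for X
    using eta_perspective[OF gamma that] by (simp add: k_def \<sigma>_def)
  have W: "W \<in> admissible"
    unfolding W_def using convex_admissible UV t by (auto simp: convex_alt)
  then have dW: "dens W > 0" by (simp add: admissible_def)
  have dens_W: "dens W = (1 - t) * dens U + t * dens V" by (simp add: W_def dens_linear)
  have \<sigma>_pos: "\<sigma> U > 0" "\<sigma> V > 0" using pos by (simp_all add: \<sigma>_def)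
  have "(1 - t) * \<sigma> U + t * \<sigma> V \<le> ((1 - t) * int_energy U + t * int_energy V) powr (1 / \<gamma>)"
    using convex_onD[OF concave_powr[of "1 / \<gamma>"], of t "int_energy U" "int_energy V"] t pos gamma
    by (simp add: \<sigma>_def)
  also have "\<dots> \<le> \<sigma> W"
    unfolding \<sigma>_def W_def using int_energy_concave[of U V t] pos t gamma
    by (intro powr_mono2) (auto intro!: add_nonneg_nonneg)
  finally have \<sigma>_W: "(1 - t) * \<sigma> U + t * \<sigma> V \<le> \<sigma> W" .
  \<comment> \<open>The Jensen weight of the perspective: the share of the density of
    \<open>W\<close> that comes from \<open>V\<close>.\<close>
  define s where "s = t * dens V / dens W"
  have s1: "1 - s = (1 - t) * dens U / dens W" using dW by (simp add: s_def dens_W field_simps)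
  have s: "0 \<le> s" "0 \<le> 1 - s"
    using t pos dW unfolding s1 by (simp_all add: s_def)
  have avg: "(1 - s) * (\<sigma> U / dens U) + s * (\<sigma> V / dens V) = ((1 - t) * \<sigma> U + t * \<sigma> V) / dens W"
    unfolding s1 using pos by (simp add: s_def add_divide_distrib)
  have "eta \<gamma> f W \<le> dens W * k (((1 - t) * \<sigma> U + t * \<sigma> V) / dens W)"
    unfolding eta[OF W] using dW \<sigma>_W \<sigma>_pos t
    by (intro mult_left_mono k_mono divide_right_mono divide_pos_pos add_pos_pos mult_pos_pos) auto
  also have "\<dots> \<le> dens W * ((1 - s) * k (\<sigma> U / dens U) + s * k (\<sigma> V / dens V))"
    unfolding avg[symmetric] using convex_onD[OF k_convex, of s "\<sigma> U / dens U" "\<sigma> V / dens V"]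
      dW s pos \<sigma>_pos by (intro mult_left_mono) auto
  also have "\<dots> = (1 - t) * eta \<gamma> f U + t * eta \<gamma> f V"
    using dW by (simp add: s1 eta UV) (simp add: s_def field_simps)
  finally show "eta \<gamma> f ((1 - t) *\<^sub>R U + t *\<^sub>R V) \<le> (1 - t) * eta \<gamma> f U + t * eta \<gamma> f V"
    by (simp add: W_def)
qed (rule convex_admissible)

section \<open>Gauss--Lobatto quadrature\<close>

lemma gauss_lobatto_exact:
  assumes "gauss_lobatto L x w" "degree p \<le> 2 * L - 3"
  shows "(\<Sum>\<alpha>=1..L. w \<alpha> * poly p (x \<alpha>)) = integral {-1..1} (poly p) / 2"
  using assms by (simp add: gauss_lobatto_def)

lemma gauss_lobatto_weight_sum:
  assumes "gauss_lobatto L x w"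
  shows "(\<Sum>\<alpha>=1..L. w \<alpha>) = 1"
proof -
  have "poly 1 = (\<lambda>_. 1 :: real)" by (simp add: fun_eq_iff)
  then show ?thesis using gauss_lobatto_exact[OF assms, of 1] by simp
qed

lemma gauss_lobatto_nodes:
  assumes "gauss_lobatto L x w" "L \<ge> 2"
  shows "inj_on x {1..L}" "x 1 = -1" "x L = 1"
    and "\<alpha> \<in> {1..L} \<Longrightarrow> \<bar>x \<alpha>\<bar> \<le> 1" "\<alpha> \<in> {2..L-1} \<Longrightarrow> \<bar>x \<alpha>\<bar> < 1"
proof -
  have sm: "strict_mono_on {1..L} x" and e: "x 1 = -1" "x L = 1"
    using assms by (auto simp: gauss_lobatto_def)
  then show "inj_on x {1..L}" "x 1 = -1" "x L = 1" by (auto intro: strict_mono_on_imp_inj_on)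
  note mono = strict_mono_onD[OF sm]
  show *: "\<bar>x \<alpha>\<bar> < 1" if "\<alpha> \<in> {2..L-1}" for \<alpha>
    using mono[of 1 \<alpha>] mono[of \<alpha> L] that e by (auto simp: abs_less_iff)
  show "\<bar>x \<alpha>\<bar> \<le> 1" if "\<alpha> \<in> {1..L}" for \<alpha>
  proof -
    have "\<alpha> = 1 \<or> \<alpha> = L \<or> \<alpha> \<in> {2..L-1}" using that by auto
    then show ?thesis using e * by (auto simp: less_imp_le)
  qed
qed

section \<open>Positivity and symmetry of the weights\<close>

lemma degree_prod_linear_le:
  "finite A \<Longrightarrow> degree (\<Prod>i\<in>A. [:c i, 1:] :: real poly) \<le> card A"
  by (simp add: degree_prod_sum_eq)

lemma poly_prod_linear_nodes:
  "finite A \<Longrightarrow> poly (\<Prod>\<beta>\<in>A. [:- x \<beta>, 1:]) y = (\<Prod>\<beta>\<in>A. y - (x \<beta> :: real))"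
  by (simp add: poly_prod)

text \<open>The rule is tested with \<open>1 - y^2\<close> times the squared product over the other
  interior nodes. This vanishes at every node but \<open>x \<alpha>\<close>, is nonnegative on the
  interval and has positive integral.\<close>

lemma gauss_lobatto_weight_pos:
  assumes gl: "gauss_lobatto L x w" and L: "L \<ge> 2" and \<alpha>: "\<alpha> \<in> {2..L-1}"
  shows "w \<alpha> > 0"
proof -
  note nodes = gauss_lobatto_nodes[OF gl L]
  define A where "A = {2..L-1} - {\<alpha>}"
  define Q where "Q = (\<Prod>\<beta>\<in>A. [:- x \<beta>, 1:])"
  define p where "p = [:1, 0, -1:] * (Q * Q)"
  \<comment> \<open>Membership of \<open>\<alpha>\<close> in \<open>{2..L-1}\<close> forces
    \<open>L \<ge> 3\<close>, so \<open>L - 3\<close> is not truncated.\<close>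
  have A: "finite A" "card A = L - 3" using \<alpha> by (auto simp: A_def)
  have "degree Q \<le> L - 3" unfolding Q_def using degree_prod_linear_le[OF A(1)] A(2) by metis
  then have "degree p \<le> 2 + (L - 3 + (L - 3))"
    unfolding p_def by (intro order_trans[OF degree_mult_le] add_mono) auto
  also have "\<dots> \<le> 2 * L - 3" using \<alpha> by auto
  finally have "(\<Sum>\<beta>=1..L. w \<beta> * poly p (x \<beta>)) = integral {-1..1} (poly p) / 2"
    by (rule gauss_lobatto_exact[OF gl])
  moreover have "(\<Sum>\<beta>=1..L. w \<beta> * poly p (x \<beta>)) = (\<Sum>\<beta>\<in>{\<alpha>}. w \<beta> * poly p (x \<beta>))"
  proof (rule sum.mono_neutral_right)
    show "\<forall>\<beta>\<in>{1..L} - {\<alpha>}. w \<beta> * poly p (x \<beta>) = 0"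
    proof
      fix \<beta> assume "\<beta> \<in> {1..L} - {\<alpha>}"
      then consider "\<beta> = 1" | "\<beta> = L" | "\<beta> \<in> A" unfolding A_def by fastforce
      then show "w \<beta> * poly p (x \<beta>) = 0"
        by cases (use nodes A in \<open>auto simp: p_def Q_def poly_prod_linear_nodes\<close>)
    qed
  qed (use \<alpha> in auto)
  ultimately have eq: "w \<alpha> * poly p (x \<alpha>) = integral {-1..1} (poly p) / 2" by simp
  have p: "poly p y = (1 - y\<^sup>2) * (poly Q y)\<^sup>2" for y
    by (simp add: p_def power2_eq_square algebra_simps)
  have p_nonneg: "poly p y \<ge> 0" if "y \<in> {-1..1}" for y
    using that by (simp add: p abs_square_le_1 abs_le_iff)
  have "x \<alpha> - x \<beta> \<noteq> 0" if "\<beta> \<in> A" for \<beta>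
    using inj_onD[OF nodes(1), of \<alpha> \<beta>] that \<alpha> by (fastforce simp: A_def)
  then have "poly Q (x \<alpha>) \<noteq> 0" using A by (simp add: Q_def poly_prod_linear_nodes)
  moreover have "1 - (x \<alpha>)\<^sup>2 > 0" using nodes(5)[OF \<alpha>] by (simp add: abs_square_less_1)
  ultimately have p_pos: "poly p (x \<alpha>) > 0" by (simp add: p)
  have "integral {-1..1} (poly p) \<noteq> 0"
    using integral_eq_0_iff[of "-1" 1 "poly p"] p_nonneg p_pos nodes(5)[OF \<alpha>]
    by (force simp: continuous_intros abs_less_iff)
  moreover have "integral {-1..1} (poly p) \<ge> 0"
    using p_nonneg by (intro integral_nonneg integrable_continuous_real) (auto intro: continuous_intros)
  ultimately show ?thesis using eq p_pos
    by (smt (verit) divide_pos_pos mult_nonpos_nonneg)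
qed

lemma integral_poly_reflect:
  "integral {-1..1} (poly (pcompose p [:0, -1:])) = integral {-1..1} (poly (p :: real poly))"
proof -
  have "poly (pcompose p [:0, -1:]) = (\<lambda>x. poly p (- x))" by (simp add: poly_pcompose fun_eq_iff)
  then show ?thesis
    using Henstock_Kurzweil_Integration.integral_reflect_real[of 1 "-1" "poly p"] by simp
qed

text \<open>The interior node polynomial \<open>P\<close> is orthogonal, with weight \<open>1 - y\<^sup>2\<close>, to all polynomials
  of degree at most \<open>L - 3\<close>, and so is its reflection; hence \<open>P\<close> is even or odd.  Testing the
  rule with \<open>(1 - y) P\<^sup>2\<close> and \<open>(1 + y) P\<^sup>2\<close> then compares the two end point weights.\<close>

lemma gauss_lobatto_end_weights:
  assumes gl: "gauss_lobatto L x w" and L: "L \<ge> 2"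
  shows "w L = w 1"
proof -
  note nodes = gauss_lobatto_nodes[OF gl L]
  define A where "A = {2..L-1}"
  have A: "finite A" "card A = L - 2" by (auto simp: A_def)
  define P where "P = (\<Prod>\<beta>\<in>A. [:- x \<beta>, 1:])"
  \<comment> \<open>The reflection of \<open>P\<close>, made monic by dropping the sign
    \<open>s\<close>.\<close>
  define R where "R = (\<Prod>\<beta>\<in>A. [:x \<beta>, 1:])"
  have degP: "degree P \<le> L - 2" and degR: "degree R \<le> L - 2"
    unfolding P_def R_def using degree_prod_linear_le[OF A(1)] A(2) by metis+
  have P0: "poly P (x \<beta>) = 0" if "\<beta> \<in> A" for \<beta>
    using that A by (auto simp: P_def poly_prod_linear_nodes)
  have split: "{1..L} = insert 1 (insert L A)" using L by (auto simp: A_def)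
  have sum_split: "(\<Sum>\<beta>=1..L. g \<beta>) = g 1 + g L + (\<Sum>\<beta>\<in>A. g \<beta>)" for g :: "nat \<Rightarrow> real"
    unfolding split using L A by (simp add: A_def)
  define s :: real where "s = (-1) ^ (L - 2)"
  have s: "s * (s * z) = z" for z
    by (simp add: s_def mult.assoc[symmetric] flip: power_mult_distrib)
  have PR: "poly P (- y) = s * poly R y" for y
  proof -
    have "poly P (- y) = (\<Prod>\<beta>\<in>A. (-1) * (y + x \<beta>))"
      by (simp add: P_def poly_prod algebra_simps)
    also have "\<dots> = s * poly R y"
      unfolding prod.distrib by (simp add: R_def poly_prod A add.commute s_def)
    finally show ?thesis .
  qed
  \<comment> \<open>Every node is a zero of this product, whose degree
    \<open>2 + (L - 2) + (L - 3)\<close> still lies within the exactness of the rule.\<close>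
  have orth: "integral {-1..1} (poly ([:1, 0, -1:] * P * q)) = 0"
    if "degree q < L - 2" for q
  proof -
    have "degree ([:1, 0, -1:] * P * q) \<le> (2 + (L - 2)) + (L - 3)"
      using that degP by (intro order_trans[OF degree_mult_le] add_mono) auto
    also have "\<dots> \<le> 2 * L - 3" using that by auto
    finally have "(\<Sum>\<beta>=1..L. w \<beta> * poly ([:1, 0, -1:] * P * q) (x \<beta>))
        = integral {-1..1} (poly ([:1, 0, -1:] * P * q)) / 2"
      by (rule gauss_lobatto_exact[OF gl])
    then show ?thesis unfolding sum_split using nodes P0 by simp
  qed
  have orthR: "integral {-1..1} (poly ([:1, 0, -1:] * R * q)) = 0"
    if "degree q < L - 2" for q
  proof -
    let ?q = "smult (s) (pcompose q [:0, -1:])"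
    have "degree (pcompose q [:0, -1:]) \<le> degree q"
      using degree_pcompose_le[of q "[:0, -1:]"] by simp
    then have "degree ?q < L - 2" using that by (meson degree_smult_le le_less_trans)
    then have "integral {-1..1} (poly (pcompose ([:1, 0, -1:] * P * ?q) [:0, -1:])) = 0"
      unfolding integral_poly_reflect by (rule orth)
    moreover have "poly (pcompose ([:1, 0, -1:] * P * ?q) [:0, -1:]) = poly ([:1, 0, -1:] * R * q)"
      by (rule ext) (simp add: poly_pcompose PR s algebra_simps)
    ultimately show ?thesis by simp
  qed
  \<comment> \<open>Both are monic of degree \<open>L - 2\<close>, so for \<open>L > 2\<close> the
    difference has lower degree and is itself an allowed test polynomial; it is then orthogonal to
    itself with weight \<open>1 - y^2\<close>.\<close>
  define d where "d = P - R"
  have "d = 0"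
  proof (cases "L = 2")
    case True
    then show ?thesis by (simp add: d_def P_def R_def A_def)
  next
    case False
    have P1: "coeff P (L - 2) = 1" and R1: "coeff R (L - 2) = 1"
    proof -
      have "lead_coeff P = 1" "lead_coeff R = 1" unfolding P_def R_def by (simp_all add: lead_coeff_prod)
      moreover have "degree P = L - 2" "degree R = L - 2"
        unfolding P_def R_def using A by (simp_all add: degree_prod_sum_eq)
      ultimately show "coeff P (L - 2) = 1" "coeff R (L - 2) = 1" by simp_all
    qed
    have "degree d < L - 2"
      unfolding d_def
      by (rule degree_lessI) (use False L P1 R1 degP degR in \<open>auto simp: le_less coeff_eq_0\<close>)
    then have "integral {-1..1} (poly ([:1, 0, -1:] * P * d)) - integral {-1..1} (poly ([:1, 0, -1:] * R * d)) = 0"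
      by (simp only: orth orthR)
    then have "integral {-1..1} (\<lambda>y. poly ([:1, 0, -1:] * P * d) y - poly ([:1, 0, -1:] * R * d) y) = 0"
      by (subst Henstock_Kurzweil_Integration.integral_diff)
        (auto intro!: integrable_continuous_real continuous_intros)
    also have "(\<lambda>y. poly ([:1, 0, -1:] * P * d) y - poly ([:1, 0, -1:] * R * d) y)
        = (\<lambda>y. (1 - y\<^sup>2) * (poly d y)\<^sup>2)"
      by (simp add: d_def power2_eq_square algebra_simps)
    finally have zero: "\<forall>y\<in>{-1..1}. (1 - y\<^sup>2) * (poly d y)\<^sup>2 = 0"
      by (subst (asm) integral_eq_0_iff)
        (auto intro!: continuous_intros simp: abs_square_le_1 abs_le_iff)
    have "poly d y = 0" if "y \<in> {-1<..<1}" for y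
    proof -
      have "y\<^sup>2 < 1" using that by (simp add: abs_square_less_1 abs_less_iff)
      moreover have "(1 - y\<^sup>2) * (poly d y)\<^sup>2 = 0" using zero that by simp
      ultimately show ?thesis by simp
    qed
    then have "{-1<..<1} \<subseteq> {y. poly d y = 0}" by blast
    then have "infinite {y. poly d y = 0}"
      by (rule infinite_super) simp
    then show "d = 0" using poly_roots_finite by blast
  qed
  then have parity: "poly P (- y) = s * poly P y" for y
    using PR by (simp add: d_def)
  have "integral {-1..1} (poly ([:1, -1:] * (P * P))) = integral {-1..1} (poly ([:1, 1:] * (P * P)))"
  proof -
    have "poly (pcompose ([:1, 1:] * (P * P)) [:0, -1:]) = poly ([:1, -1:] * (P * P))"
      by (rule ext) (simp add: poly_pcompose parity s algebra_simps)
    then show ?thesis using integral_poly_reflect[of "[:1, 1:] * (P * P)"] by simp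
  qed
  \<comment> \<open>The degree bound \<open>1 + 2 * (L - 2)\<close> is the limit of exactness. For
    \<open>c = -1\<close> and \<open>c = 1\<close> the linear factor removes one end point, and
    \<open>P\<close> removes the interior nodes.\<close>
  moreover have "(\<Sum>\<beta>=1..L. w \<beta> * poly ([:1, c:] * (P * P)) (x \<beta>))
      = integral {-1..1} (poly ([:1, c:] * (P * P))) / 2" for c
  proof (rule gauss_lobatto_exact[OF gl])
    have "degree ([:1, c:] * (P * P)) \<le> 1 + ((L - 2) + (L - 2))"
      using degP by (intro order_trans[OF degree_mult_le] add_mono) auto
    also have "\<dots> \<le> 2 * L - 3" using L by auto
    finally show "degree ([:1, c:] * (P * P)) \<le> 2 * L - 3" .
  qed
  ultimately have "(\<Sum>\<beta>=1..L. w \<beta> * poly ([:1, -1:] * (P * P)) (x \<beta>))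
      = (\<Sum>\<beta>=1..L. w \<beta> * poly ([:1, 1:] * (P * P)) (x \<beta>))" by (simp only:)
  then have "w 1 * (poly P (-1))\<^sup>2 = w L * (poly P 1)\<^sup>2"
    unfolding sum_split using nodes P0 by (simp add: power2_eq_square)
  moreover have "(poly P (-1))\<^sup>2 = (poly P 1)\<^sup>2"
    using parity[of 1] by (simp add: power2_eq_square s algebra_simps)
  moreover have "poly P 1 \<noteq> 0"
    using A nodes(5) by (fastforce simp: P_def poly_prod_linear_nodes A_def)
  ultimately show ?thesis by simp
qed

text \<open>Componentwise, the affine pullback to the reference interval keeps the degree, so the
  rule is exact on it.\<close>

lemma gauss_lobatto_cell_average:
  fixes u :: "real \<Rightarrow> 'a::euclidean_space"
  assumes gl: "gauss_lobatto L x w" and k: "k \<le> 2 * L - 3" and h: "h > 0"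
    and u: "poly_on k {a..a + h} u" and L: "L \<ge> 2"
  shows "(1 / h) *\<^sub>R integral {a..a + h} u = (\<Sum>\<alpha>=1..L. w \<alpha> *\<^sub>R u (a + h * (x \<alpha> + 1) / 2))"
proof (rule euclidean_eqI)
  fix b :: 'a assume b: "b \<in> Basis"
  have poly: "\<exists>p. degree p \<le> k \<and> (\<forall>y\<in>{a..a + h}. u y \<bullet> b = poly p y)" if "b \<in> Basis" for b
    using u that by (auto simp: poly_on_def)
  have int: "u integrable_on {a..a + h}"
  proof (rule integrable_componentwise)
    fix b :: 'a assume "b \<in> Basis"
    then obtain p where "\<forall>y\<in>{a..a + h}. u y \<bullet> b = poly p y" using poly by blast
    moreover have "poly p integrable_on {a..a + h}"
      by (intro integrable_continuous_real continuous_intros)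
    ultimately show "(\<lambda>y. u y \<bullet> b) integrable_on {a..a + h}"
      using integrable_cong by metis
  qed
  obtain p where p: "degree p \<le> k" "\<And>y. y \<in> {a..a + h} \<Longrightarrow> u y \<bullet> b = poly p y"
    using poly[OF b] by auto
  define q where "q = pcompose p [:a + h / 2, h / 2:]"
  have q: "poly q y = poly p (h / 2 * y + (a + h / 2))" for y
    by (simp add: q_def poly_pcompose algebra_simps)
  have "degree q \<le> degree p * degree [:a + h / 2, h / 2:]"
    unfolding q_def by (rule degree_pcompose_le)
  also have "\<dots> = degree p" using h by simp
  finally have q_exact: "(\<Sum>\<alpha>=1..L. w \<alpha> * poly q (x \<alpha>)) = integral {-1..1} (poly q) / 2"
    using p k by (intro gauss_lobatto_exact[OF gl]) auto
  have "(poly p has_integral integral {a..a + h} (poly p)) (cbox a (a + h))"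
    by (auto intro!: integrable_integral integrable_continuous_real continuous_intros)
  from has_integral_affinity'[OF this, of "h / 2" "a + h / 2"] h
  have "(poly q has_integral 2 / h * integral {a..a + h} (poly p)) {-1..1}"
    by (simp add: q[abs_def] field_simps)
  then have "integral {-1..1} (poly q) / 2 = 1 / h * integral {a..a + h} (poly p)"
    by (simp add: integral_unique)
  moreover have "integral {a..a + h} (\<lambda>y. u y \<bullet> b) = integral {a..a + h} (poly p)"
    using p(2) by (rule integral_cong)
  \<comment> \<open>The components are known to be polynomial only on the cell, so the nodes must be
    located inside it.\<close>
  moreover have "u (a + h * (x \<alpha> + 1) / 2) \<bullet> b = poly q (x \<alpha>)" if "\<alpha> \<in> {1..L}" for \<alpha>
  proof -
    have x: "\<bar>x \<alpha>\<bar> \<le> 1" using gauss_lobatto_nodes(4)[OF gl L that] .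
    then have "0 \<le> h * (x \<alpha> + 1)" using h by (auto simp: abs_le_iff)
    moreover have "h * (x \<alpha> + 1) \<le> h * 2" using h x by (intro mult_left_mono) (auto simp: abs_le_iff)
    ultimately have "a + h * (x \<alpha> + 1) / 2 \<in> {a..a + h}" by auto
    from p(2)[OF this] show ?thesis by (simp add: q algebra_simps add_divide_distrib)
  qed
  ultimately show "((1 / h) *\<^sub>R integral {a..a + h} u) \<bullet> b
      = (\<Sum>\<alpha>=1..L. w \<alpha> *\<^sub>R u (a + h * (x \<alpha> + 1) / 2)) \<bullet> b"
    using q_exact int by (simp add: inner_sum_left)
qed

section \<open>Convex splitting of the update\<close>

lemma hll_flux_eq_left:
  assumes "l \<noteq> r"
  shows "hll_flux l r um up fm fp = fm + l *\<^sub>R (hll_mean l r um up fm fp - um)"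
proof -
  have mean: "(r - l) *\<^sub>R hll_mean l r um up fm fp = r *\<^sub>R up - l *\<^sub>R um - fp + fm"
    using assms by (simp add: hll_mean_def)
  have "(r - l) *\<^sub>R hll_flux l r um up fm fp = r *\<^sub>R fm - l *\<^sub>R fp + (r * l) *\<^sub>R (up - um)"
    using assms by (simp add: hll_flux_def)
  also have "\<dots> = (r - l) *\<^sub>R fm + l *\<^sub>R ((r - l) *\<^sub>R hll_mean l r um up fm fp - (r - l) *\<^sub>R um)"
    unfolding mean by (simp add: algebra_simps)
  also have "\<dots> = (r - l) *\<^sub>R (fm + l *\<^sub>R (hll_mean l r um up fm fp - um))"
    by (simp add: algebra_simps)
  finally show ?thesis using assms by simp
qed

lemma hll_flux_eq_right:
  assumes "l \<noteq> r"
  shows "hll_flux l r um up fm fp = fp + r *\<^sub>R (hll_mean l r um up fm fp - up)"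
proof -
  have "(r - l) *\<^sub>R hll_mean l r um up fm fp = r *\<^sub>R up - l *\<^sub>R um - fp + fm"
    using assms by (simp add: hll_mean_def)
  then show ?thesis unfolding hll_flux_eq_left[OF assms] by (simp add: algebra_simps)
qed

text \<open>Each end node's mass is split as \<open>w = \<kappa> (bL + r)\<close> and
  \<open>w = \<kappa> (bR - l')\<close>. The parts with \<open>r\<close> and \<open>l'\<close>
  cancel against the interface fluxes; the rest, with the one-sided fluxes, forms the splitting
  mean.\<close>

lemma hll_splitting:
  fixes uL :: "'a::real_vector"
  assumes "l \<noteq> r" "l' \<noteq> r'" "\<kappa> \<noteq> 0" and bL: "bL = w / \<kappa> - r" and bR: "bR = w / \<kappa> + l'"
    and "bL + bR \<noteq> 0"
  shows "w *\<^sub>R uL + w *\<^sub>R uR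
      - \<kappa> *\<^sub>R (hll_flux l' r' uR up fR fp - hll_flux l r um uL fm fL)
    = (\<kappa> * r) *\<^sub>R hll_mean l r um uL fm fL + (\<kappa> * (bL + bR)) *\<^sub>R split_mean bL bR uL uR fL fR
      + (- \<kappa> * l') *\<^sub>R hll_mean l' r' uR up fR fp"
proof -
  have b: "\<kappa> * bL = w - \<kappa> * r" "\<kappa> * bR = w + \<kappa> * l'"
    using \<open>\<kappa> \<noteq> 0\<close> by (simp_all add: bL bR algebra_simps)
  have "(\<kappa> * (bL + bR)) *\<^sub>R split_mean bL bR uL uR fL fR
      = \<kappa> *\<^sub>R (bR *\<^sub>R uR + bL *\<^sub>R uL - fR + fL)"
    using \<open>bL + bR \<noteq> 0\<close> by (simp add: split_mean_def)
  also have "\<dots> = (w + \<kappa> * l') *\<^sub>R uR + (w - \<kappa> * r) *\<^sub>R uL - \<kappa> *\<^sub>R fR + \<kappa> *\<^sub>R fL"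
    by (simp only: scaleR_right_distrib scaleR_right_diff_distrib scaleR_scaleR b)
  finally show ?thesis
    unfolding hll_flux_eq_left[OF \<open>l' \<noteq> r'\<close>] hll_flux_eq_right[OF \<open>l \<noteq> r\<close>]
    by (simp add: algebra_simps)
qed

section \<open>The interior splitting state and the final estimate\<close>

lemma alpha_le_alpha_star:
  "alpha_r \<gamma> U V \<xi> \<le> alpha_star \<gamma> U V \<xi>"
  "- alpha_star \<gamma> U V \<xi> \<le> alpha_l \<gamma> U V \<xi>"
  unfolding alpha_r_def alpha_l_def alpha_star_def by linarith+

text \<open>Through this identity \<open>hll_mean_admissible\<close> also yields the admissibility
  of the interior splitting state.\<close>

lemma split_mean_eq_hll_mean: "split_mean bL bR uL uR fL fR = hll_mean (- bL) bR uL uR fL fR"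
  by (simp add: split_mean_def hll_mean_def add.commute)

theorem theorem2p6:
  fixes \<gamma> B_const :: real
    and f :: "nat \<Rightarrow> real \<Rightarrow> real"
    and M k :: nat
    and S :: scheme
  assumes gamma: "\<gamma> > 1"
    and generators: "\<forall>r\<in>{1..M}. entropy_generator \<gamma> (f r)"
    and mesh: "dx S > 0" "tau S > 0"
    and quadrature: "npts S \<ge> 2" "2 * npts S - 3 \<ge> k" "k = 0 \<longrightarrow> npts S = 2"
      "gauss_lobatto (npts S) (node S) (weight S)"
    and polynomial: "\<forall>j\<in>{1..ncells S}. poly_on k (cell S j) (sol S j)"
    and B1_const: "\<forall>j\<in>{1..ncells S}. \<forall>x\<in>cell S j. mag (sol S j x) $ 1 = B_const"
    and states: "\<forall>j\<in>{1..ncells S}. \<forall>\<alpha>\<in>{1..npts S}. Uhat S j \<alpha> \<in> admissible_B B_const"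
    and exterior: "ext_left S \<in> admissible_B B_const" "ext_right S \<in> admissible_B B_const"
    and speeds: "\<forall>i\<in>{0..ncells S}.
        am S i < min 0 (alpha_l \<gamma> (Um S i) (Up S i) e1) \<and>
        ap S i > max 0 (alpha_r \<gamma> (Up S i) (Um S i) e1)"
    and CFL: "\<forall>j\<in>{1..ncells S}.
        lam S * max (alpha_cell \<gamma> S j + ap S (j - 1)) (alpha_cell \<gamma> S j - am S j) < weight S 1"
    and entropy_H: "\<forall>r\<in>{1..M}. \<forall>i\<in>{0..ncells S}.
        eta \<gamma> (f r) (H_state \<gamma> S i) \<le> E_HLL \<gamma> (f r) S i"
    and entropy_Xi: "\<forall>r\<in>{1..M}. \<forall>j\<in>{1..ncells S}.
        eta \<gamma> (f r) (Xi_state \<gamma> S j) \<le> E_Xi \<gamma> (f r) S j"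
  shows "weakly_multi_entropy_stable \<gamma> B_const f M (ncells S) (update \<gamma> S)
           (\<lambda>j r. budget \<gamma> (f r) S j)"
proof -
  define N where "N = ncells S"
  define h where "h = lam S"
  have h: "h > 0" using mesh by (simp add: h_def lam_def)
  note L = quadrature(1) and gl = quadrature(4)
  have UL: "UL S j \<in> admissible_B B_const" and UR: "UR S j \<in> admissible_B B_const"
    if "j \<in> {1..N}" for j
    using states that L by (auto simp: UL_def UR_def N_def)
  have traces: "Um S i \<in> admissible_B B_const" "Up S i \<in> admissible_B B_const" if "i \<le> N" for i
    using UL[of "i + 1"] UR[of i] that exterior by (auto simp: Um_def Up_def N_def)
  have sp: "am S i < 0" "ap S i > 0" "am S i < alpha_l \<gamma> (Um S i) (Up S i) e1"
      "ap S i > alpha_r \<gamma> (Up S i) (Um S i) e1" if "i \<le> N" for i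
    using speeds that by (auto simp: N_def)
  have H: "H_state \<gamma> S i \<in> admissible_B B_const" if "i \<le> N" for i
    unfolding H_state_def using hll_mean_admissible(2)[OF gamma traces[OF that] sp(4,3)[OF that]] .
  have "update \<gamma> S j \<in> admissible_B B_const \<and>
      (\<forall>r\<in>{1..M}. eta \<gamma> (f r) (update \<gamma> S j) \<le> budget \<gamma> (f r) S j)" if j: "j \<in> {1..N}" for j
  proof -
    have jN: "j \<le> N" "j - 1 \<le> N" "0 < j" using j by auto
    define bL bR where "bL = beta_L S j" and "bR = beta_R S j"
    \<comment> \<open>The traces on the inner sides of cell \<open>j\<close> never fall under the
      exterior cases of \<open>Um\<close> and \<open>Up\<close>.\<close>
    have Um_j: "Um S j = UR S j" and Up_j: "Up S (j - 1) = UL S j"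
      using j by (auto simp: Um_def Up_def N_def)
    let ?y = "alpha_cell \<gamma> S j + ap S (j - 1)" and ?z = "alpha_cell \<gamma> S j - am S j"
    have "h * max ?y ?z < weight S 1" using CFL j by (simp add: N_def h_def)
    moreover have "h * ?y \<le> h * max ?y ?z" "h * ?z \<le> h * max ?y ?z" using h by simp_all
    ultimately have "h * ?y < weight S 1" "h * ?z < weight S 1" by linarith+
    \<comment> \<open>Divided by \<open>h\<close>, the CFL condition says exactly this;
      \<open>alpha_cell\<close> in turn dominates the one-sided speeds.\<close>
    then have b: "bL > alpha_cell \<gamma> S j" "bR > alpha_cell \<gamma> S j"
      using h by (simp_all add: bL_def bR_def beta_L_def beta_R_def h_def[symmetric] field_simps)
    then have sp_Xi: "alpha_r \<gamma> (UR S j) (UL S j) e1 < bR" "- bL < alpha_l \<gamma> (UL S j) (UR S j) e1"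
      using alpha_le_alpha_star(1)[of \<gamma> "UR S j" "UL S j" e1]
        alpha_le_alpha_star(2)[of \<gamma> "UL S j" "UR S j" e1]
      unfolding alpha_cell_def by linarith+
    note Xi_adm = hll_mean_admissible[OF gamma UL[OF j] UR[OF j] sp_Xi]
    have Xi: "Xi_state \<gamma> S j \<in> admissible_B B_const"
      using Xi_adm(2) by (simp add: Xi_state_def split_mean_eq_hll_mean bL_def bR_def)
    have D: "bL + bR > 0" using Xi_adm(1) by simp
    define A where "A = {2..npts S - 1}"
    define w where "w = weight S 1"
    \<comment> \<open>Both \<open>beta_L\<close> and \<open>beta_R\<close> use the first weight,
      while the right end node carries the last one.\<close>
    have w_end: "weight S (npts S) = w" unfolding w_def by (rule gauss_lobatto_end_weights[OF gl L])
    have nodes: "{1..npts S} = insert 1 (insert (npts S) A)" "1 \<notin> insert (npts S) A" "npts S \<notin> A"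
      "finite A" "0 \<notin> A"
      using L by (auto simp: A_def)
    \<comment> \<open>Two end nodes are replaced by three states, hence the extra index 0: it holds
      the left \<open>H\<close>, index 1 holds \<open>\<Xi>\<close>, and the last index holds the
      right \<open>H\<close>.\<close>
    define I where "I = insert 0 (insert 1 (insert (npts S) A))"
    have sum_I: "sum g I = g 0 + g 1 + g (npts S) + sum g A" for g :: "nat \<Rightarrow> 'b::comm_monoid_add"
      using nodes L by (simp add: I_def add.assoc)
    have sum_nodes: "(\<Sum>\<alpha>=1..npts S. g \<alpha>) = g 1 + g (npts S) + sum g A" for g :: "nat \<Rightarrow> 'b::comm_monoid_add"
      using nodes by (simp add: add.assoc)
    define c where "c \<alpha> = (if \<alpha> = 0 then h * ap S (j - 1) else if \<alpha> = 1 then h * (bL + bR)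
      else if \<alpha> = npts S then - h * am S j else weight S \<alpha>)" for \<alpha>
    define Y where "Y \<alpha> = (if \<alpha> = 0 then H_state \<gamma> S (j - 1) else if \<alpha> = 1 then Xi_state \<gamma> S j
      else if \<alpha> = npts S then H_state \<gamma> S j else Uhat S j \<alpha>)" for \<alpha>
    have cY: "c 0 = h * ap S (j - 1)" "c 1 = h * (bL + bR)" "c (npts S) = - h * am S j"
      "Y 0 = H_state \<gamma> S (j - 1)" "Y 1 = Xi_state \<gamma> S j" "Y (npts S) = H_state \<gamma> S j"
      using L by (simp_all add: c_def Y_def)
    have cY_A: "c \<alpha> = weight S \<alpha>" "Y \<alpha> = Uhat S j \<alpha>" if "\<alpha> \<in> A" for \<alpha>
      using that by (auto simp: c_def Y_def A_def)
    have c_nonneg: "c \<alpha> \<ge> 0" if "\<alpha> \<in> I" for \<alpha>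
    proof -
      have "weight S \<alpha> > 0" if "\<alpha> \<in> A"
        using gauss_lobatto_weight_pos[OF gl L] that by (simp add: A_def)
      moreover have "c 0 \<ge> 0" "c 1 \<ge> 0" "c (npts S) \<ge> 0"
        using h D sp(1)[OF jN(1)] sp(2)[OF jN(2)] unfolding cY
        by (auto intro: mult_nonneg_nonneg mult_nonneg_nonpos)
      ultimately show ?thesis using that cY_A(1) by (auto simp: I_def less_imp_le)
    qed
    have Y_adm: "Y \<alpha> \<in> admissible_B B_const" if "\<alpha> \<in> I" for \<alpha>
    proof -
      have "Uhat S j \<alpha> \<in> admissible_B B_const" if "\<alpha> \<in> A"
        using states j that nodes(1) by (auto simp: N_def)
      then show ?thesis using that H[OF jN(1)] H[OF jN(2)] Xi cY_A(2) cY(4-6) by (auto simp: I_def)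
    qed
    have c_sum: "sum c I = 1"
    proof -
      have "(\<Sum>\<alpha>=1..npts S. weight S \<alpha>) = 1"
        by (rule gauss_lobatto_weight_sum[OF gl])
      then have "w + w + sum (weight S) A = 1" unfolding sum_nodes w_end w_def .
      moreover have "sum c I = h * (ap S (j - 1) + bL + bR - am S j) + sum (weight S) A"
        unfolding sum_I cY using cY_A(1) by (simp add: algebra_simps)
      moreover have "h * (ap S (j - 1) + bL + bR - am S j) = w + w"
        using h by (simp add: bL_def bR_def beta_L_def beta_R_def h_def[symmetric] w_def field_simps)
      ultimately show ?thesis by simp
    qed
    \<comment> \<open>Kept polymorphic: it is used for states with their flux and for real entropies
      with theirs.\<close>
    have split: "w *\<^sub>R uL + w *\<^sub>R uR
        - h *\<^sub>R (hll_flux (am S j) (ap S j) uR up fR fp - hll_flux (am S (j - 1)) (ap S (j - 1)) um uL fm fL)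
      = c 0 *\<^sub>R hll_mean (am S (j - 1)) (ap S (j - 1)) um uL fm fL
        + c 1 *\<^sub>R split_mean bL bR uL uR fL fR
        + c (npts S) *\<^sub>R hll_mean (am S j) (ap S j) uR up fR fp"
      for uL uR um up fL fR fm fp :: "'b::real_vector"
      unfolding cY
    proof (rule hll_splitting)
      show "am S (j - 1) \<noteq> ap S (j - 1)" "am S j \<noteq> ap S j"
        using sp(1,2)[OF jN(1)] sp(1,2)[OF jN(2)] by auto
      show "h \<noteq> 0" "bL + bR \<noteq> 0" using h D by auto
      show "bL = w / h - ap S (j - 1)" "bR = w / h + am S j"
        by (simp_all add: bL_def bR_def beta_L_def beta_R_def h_def w_def)
    qed
    have avg: "cell_avg S j = (\<Sum>\<alpha>=1..npts S. weight S \<alpha> *\<^sub>R Uhat S j \<alpha>)"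
    proof -
      have cell: "cell S j = {xi S (j - 1)..xi S (j - 1) + dx S}"
        using j by (simp add: cell_def xi_def of_nat_diff algebra_simps)
      have "poly_on k (cell S j) (sol S j)" using polynomial j by (simp add: N_def)
      from gauss_lobatto_cell_average[OF gl quadrature(2) mesh(1) this[unfolded cell] L]
      show ?thesis unfolding cell_avg_def Uhat_def cell_node_def cell .
    qed
    have update: "update \<gamma> S j = (\<Sum>\<alpha>\<in>I. c \<alpha> *\<^sub>R Y \<alpha>)"
    proof -
      have "update \<gamma> S j = (w *\<^sub>R UL S j + w *\<^sub>R UR S j - h *\<^sub>R (num_flux \<gamma> S j - num_flux \<gamma> S (j - 1)))
          + (\<Sum>\<alpha>\<in>A. weight S \<alpha> *\<^sub>R Uhat S j \<alpha>)"
        unfolding update_def avg sum_nodes w_end UL_def UR_def h_def w_def by simp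
      also have "w *\<^sub>R UL S j + w *\<^sub>R UR S j - h *\<^sub>R (num_flux \<gamma> S j - num_flux \<gamma> S (j - 1))
          = c 0 *\<^sub>R Y 0 + c 1 *\<^sub>R Y 1 + c (npts S) *\<^sub>R Y (npts S)"
        unfolding num_flux_def Um_j Up_j split cY(4-6) H_state_def Xi_state_def bL_def bR_def ..
      also have "(\<Sum>\<alpha>\<in>A. weight S \<alpha> *\<^sub>R Uhat S j \<alpha>) = (\<Sum>\<alpha>\<in>A. c \<alpha> *\<^sub>R Y \<alpha>)"
        by (rule sum.cong) (simp_all add: cY_A)
      finally show ?thesis unfolding sum_I .
    qed
    have "eta \<gamma> (f r) (update \<gamma> S j) \<le> budget \<gamma> (f r) S j" if r: "r \<in> {1..M}" for r
    proof -
      let ?e = "eta \<gamma> (f r)"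
      have f: "entropy_generator \<gamma> (f r)" using generators r by blast
      have "?e (update \<gamma> S j) \<le> (\<Sum>\<alpha>\<in>I. c \<alpha> * ?e (Y \<alpha>))"
        unfolding update
      proof (rule convex_on_sum[OF _ _ eta_convex[OF gamma f] c_sum])
        show "Y \<alpha> \<in> admissible" if "\<alpha> \<in> I" for \<alpha>
          using Y_adm[OF that] by (rule admissible_B_D)
      qed (use nodes c_nonneg in \<open>auto simp: I_def\<close>)
      also have "\<dots> = c 0 * ?e (H_state \<gamma> S (j - 1)) + c 1 * ?e (Xi_state \<gamma> S j)
          + c (npts S) * ?e (H_state \<gamma> S j) + (\<Sum>\<alpha>\<in>A. weight S \<alpha> * ?e (Uhat S j \<alpha>))"
        unfolding sum_I cY(4-6) by (simp add: cY_A)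
      also have "\<dots> \<le> c 0 * E_HLL \<gamma> (f r) S (j - 1) + c 1 * E_Xi \<gamma> (f r) S j
          + c (npts S) * E_HLL \<gamma> (f r) S j + (\<Sum>\<alpha>\<in>A. weight S \<alpha> * ?e (Uhat S j \<alpha>))"
        using entropy_H entropy_Xi r j jN
        by (intro add_mono mult_left_mono order_refl c_nonneg) (auto simp: I_def N_def)
      \<comment> \<open>The splitting identity read backwards, with entropies in place of
        states.\<close>
      also have "c 0 * E_HLL \<gamma> (f r) S (j - 1) + c 1 * E_Xi \<gamma> (f r) S j + c (npts S) * E_HLL \<gamma> (f r) S j
          = w * ?e (UL S j) + w * ?e (UR S j)
            - h * (num_eta_flux \<gamma> (f r) S j - num_eta_flux \<gamma> (f r) S (j - 1))"
        unfolding num_eta_flux_def E_HLL_def E_Xi_def Um_j Up_j bL_def[symmetric] bR_def[symmetric]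
          real_scaleR_def[symmetric] split ..
      also have "\<dots> + (\<Sum>\<alpha>\<in>A. weight S \<alpha> * ?e (Uhat S j \<alpha>)) = budget \<gamma> (f r) S j"
        unfolding budget_def sum_nodes w_end UL_def UR_def h_def w_def by simp
      finally show ?thesis .
    qed
    moreover have "update \<gamma> S j \<in> admissible_B B_const"
      unfolding update using nodes c_nonneg Y_adm c_sum
      by (intro convex_sum convex_admissible_B) (auto simp: I_def)
    ultimately show ?thesis by blast
  qed
  then show ?thesis unfolding weakly_multi_entropy_stable_def N_def by blast
qed

end
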